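(* Let $A(z)\in\mathcal P(S^1)^{m\times n}$. Then there exists a singular value decomposition $A(z)=U(z)S(z)V(z)^P$, where $S(z)\in\mathcal P(S^1)^{m\times n}$ is (possibly rectangular) diagonal and real for all $z\in S^1$, and $U(z)\in\mathcal P(S^1)^{m\times m}$ and $V(z)\in\mathcal P(S^1)^{n\times n}$ are both para-unitary.
   Context: $S^1=\{z\in\mathbb C:|z|=1\}$. $\mathcal H(S^1)$ is the ring of functions holomorphic on $S^1$, i.e. admitting a holomorphic extension to some open neighbourhood of $S^1$ (equivalently, Laurent series $\sum_{k\in\mathbb Z}a_kz^k$ converging in an open annulus containing $S^1$). For a positive integer $N$ and $z\neq0$, $z^{1/N}:=|z|^{1/N}\exp(\mathrm i\arg(z)/N)$ with $\arg(z)\in(-\pi,\pi]$. $\mathcal H_N(S^1)$ is the space of convergent Laurent series in the variable $z^{1/N}$, i.e. of functions $f(z)=g(z^{1/N})$ with $g\in\mathcal H(S^1)$, and $\mathcal P(S^1):=\bigcup_{N>0}\mathcal H_N(S^1)$. For $A(z)=[a_{i,j}(z)]\in\mathcal P(S^1)^{m\times n}$, the para-Hermitian conjugate $A(z)^P\in\mathcal P(S^1)^{n\times m}$ is the matrix whose $(i,j)$ entry is $\overline{a_{j,i}(\overline z^{-1})}$; on $S^1$ it coincides with the conjugate transpose $A(z)^*$. A square matrix $U(z)$ over $\mathcal P(S^1)$ is para-unitary if $U(z)U(z)^P=U(z)^PU(z)=I$. In this singular value decomposition the diagonal entries of $S(z)$ are allowed to take negative values and are not necessarily ordered. *)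

theory Defs
  imports
    "HOL-Complex_Analysis.Complex_Analysis"
    "Jordan_Normal_Form.Matrix"
begin

text \<open>
  Functions holomorphic on the unit circle are germs: they are only determined on some unspecified
  neighbourhood of the circle. They are represented by total functions of type
  \<^typ>\<open>complex \<Rightarrow> complex\<close>, whose values away from the circle are irrelevant, and identities
  between them are required on a whole neighbourhood of the circle, not only on the circle.
\<close>

definition near_circle :: "(complex \<Rightarrow> bool) \<Rightarrow> bool" where
  "near_circle P \<longleftrightarrow> (\<exists>T. open T \<and> sphere 0 1 \<subseteq> T \<and> (\<forall>z\<in>T. P z))"

definition holo_circle :: "(complex \<Rightarrow> complex) set" where
  "holo_circle = {g. g analytic_on sphere 0 1}"

text \<open>The library function \<^const>\<open>Arg\<close> takes values in the interval from $-\pi$ (exclusive)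
  to $\pi$ (inclusive).\<close>

definition proot :: "nat \<Rightarrow> complex \<Rightarrow> complex" where
  "proot N z = complex_of_real (root N (cmod z)) * exp (\<i> * complex_of_real (Arg z) / of_nat N)"

definition holo_root_circle :: "nat \<Rightarrow> (complex \<Rightarrow> complex) set" where
  "holo_root_circle N = {f. \<exists>g\<in>holo_circle. near_circle (\<lambda>z. f z = g (proot N z))}"

definition puiseux_circle :: "(complex \<Rightarrow> complex) set" where
  "puiseux_circle = (\<Union>N\<in>{0<..}. holo_root_circle N)"

text \<open>A matrix over a function ring is represented as a matrix-valued function.\<close>

definition puiseux_mat :: "nat \<Rightarrow> nat \<Rightarrow> (complex \<Rightarrow> complex mat) set" where
  "puiseux_mat m n =
     {A. (\<forall>z. A z \<in> carrier_mat m n) \<and>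
         (\<forall>i<m. \<forall>j<n. (\<lambda>z. A z $$ (i, j)) \<in> puiseux_circle)}"

definition para_conj :: "(complex \<Rightarrow> complex mat) \<Rightarrow> complex \<Rightarrow> complex mat" where
  "para_conj A z = map_mat cnj (transpose_mat (A (inverse (cnj z))))"

definition para_unitary :: "nat \<Rightarrow> (complex \<Rightarrow> complex mat) \<Rightarrow> bool" where
  "para_unitary n U \<longleftrightarrow>
     U \<in> puiseux_mat n n \<and>
     near_circle (\<lambda>z. U z * para_conj U z = 1\<^sub>m n \<and> para_conj U z * U z = 1\<^sub>m n)"

end

theory Submission
  imports Defs "HOL-Computational_Algebra.Fundamental_Theorem_Algebra" "Jordan_Normal_Form.Char_Poly"
begin

text \<open>Put $z = e^{\mathrm i t}$. A function $g(z^{1/N})$ of $\mathcal P(S^1)$ becomes, continued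
analytically beyond $|t| \le \pi$, the real-analytic function $g(e^{\mathrm i t/N})$ of $t \in \mathbb R$
with the period $2\pi N$; these functions form an integral domain, here the type
\<open>puis\<close>, and para-Hermitian conjugation becomes pointwise complex conjugation. The decomposition
is first found over this domain, as an identity between matrices, and then carried to a
neighbourhood of the circle.

Two facts about the domain carry the proof.

Divisibility (\<open>divides_if_norm_le\<close>): if $|a(t)| \le |c(t)|$ for all real $t$, then $c$ divides $a$,
because the quotient is meromorphic and a bounded function has no poles.

Rellich's theorem (\<open>real_rooted_has_root\<close>): a monic polynomial over the domain all of whose roots
are real at every real $t$ has a root in the domain. A divisor of minimal degree of the given
polynomial has no multiple roots on a thin open strip above the real line. There its roots form a
finite covering of a convex set, so there is a holomorphic root branch. Near the real line the
values of this branch are close to finitely many real numbers, hence the branch has real continuous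
boundary values, and Schwarz reflection extends it to a full strip. Points of the real line at which
roots cross need no separate treatment since they are only approached from above. As there are
finitely many roots, two translates of the branch by multiples of the period of the coefficients
coincide, so the branch is periodic with a larger period; this is where roots of $z$ come in.

The linear algebra uses nothing else. Applied to $x^2 - h$, Rellich's theorem gives a square root of
a nonnegative $h$; with divisibility, every nonzero vector is a real multiple of a vector of norm $1$
(\<open>normalize_vec\<close>), and a reflection-like matrix $I - w w^* / \beta$ is a unitary matrix with a
prescribed column (\<open>unitary_with_column\<close>), although $\beta$ may have zeros. Applied to the
characteristic polynomial of $A^* A$, Rellich's theorem gives a right singular vector $v$. If
$A v \ne 0$, then $A v = r u$ with $r$ real and $u$ of norm $1$, and $A^* u = r v$; unitary matrices
with the columns $u$ and $v$ split off a $1 \times 1$ block from $A$. If $A v = 0$, a zero column is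
split off. Induction on the number of columns finishes the proof (\<open>svd_exists\<close>). Since $r$ is only
required to be real, no choice of signs or of an order, which would destroy analyticity, is made.\<close>

section \<open>Roots of a complex polynomial as functions of its coefficients\<close>

lemma norm_poly_ge_if_no_near_root:
  fixes p :: "complex poly"
  assumes "\<And>y. poly p y = 0 \<Longrightarrow> e \<le> dist x y" "0 \<le> e"
  shows "norm (lead_coeff p) * e ^ degree p \<le> norm (poly p x)"
proof -
  obtain r where r: "Polynomial.smult (lead_coeff p) (\<Prod>i<degree p. [:-r i, 1:]) = p"
    by (rule complex_poly_decompose')
  have eval: "poly p y = lead_coeff p * (\<Prod>i<degree p. y - r i)" for y
    by (subst r[symmetric]) (simp add: poly_prod)
  have "e \<le> norm (x - r i)" if "i < degree p" for i
  proof -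
    have "poly p (r i) = 0"
      using that by (subst eval) auto
    then show ?thesis using assms(1) by (simp add: dist_norm)
  qed
  then have "(\<Prod>i<degree p. e) \<le> (\<Prod>i<degree p. norm (x - r i))"
    using assms(2) by (intro prod_mono) auto
  then show ?thesis
    by (subst eval) (simp add: norm_mult prod_norm mult_left_mono)
qed

lemma poly_eq_sum_upto:
  fixes p :: "'a::comm_semiring_1 poly"
  assumes "degree p \<le> d"
  shows "poly p x = (\<Sum>i\<le>d. coeff p i * x ^ i)"
  unfolding poly_altdef
  by (rule sum.mono_neutral_left) (use assms in \<open>auto simp: coeff_eq_0\<close>)

text \<open>If no root of $P_z$ were near \<open>x\<close>, then $P_z(x)$ would be bounded below by the leading coefficient
times a power of the distance; but $P_z(x)$ tends to $P_{z_0}(x) = 0$.\<close>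

lemma eventually_root_near:
  fixes P :: "complex \<Rightarrow> complex poly"
  assumes cont: "\<And>k. continuous (at z0 within S) (\<lambda>z. coeff (P z) k)"
    and deg: "\<And>z. z \<in> S \<Longrightarrow> degree (P z) = d" and "0 < d" "z0 \<in> S"
    and root: "poly (P z0) x = 0" and "0 < e"
  shows "\<forall>\<^sub>F z in at z0 within S. \<exists>y\<in>ball x e. poly (P z) y = 0"
proof -
  define c where "c = norm (lead_coeff (P z0))"
  have "0 < c" using assms(3) deg[OF \<open>z0 \<in> S\<close>] by (auto simp: c_def)
  have inS: "\<forall>\<^sub>F z in at z0 within S. z \<in> S"
    by (simp add: eventually_at_filter)
  have "((\<lambda>z. \<Sum>i\<le>d. coeff (P z) i * x ^ i) \<longlongrightarrow> (\<Sum>i\<le>d. coeff (P z0) i * x ^ i)) (at z0 within S)"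
    using cont by (intro tendsto_intros) (auto simp: continuous_within)
  moreover have "(\<Sum>i\<le>d. coeff (P z0) i * x ^ i) = 0"
    using root deg[OF \<open>z0 \<in> S\<close>] by (simp flip: poly_eq_sum_upto)
  ultimately have "((\<lambda>z. norm (\<Sum>i\<le>d. coeff (P z) i * x ^ i)) \<longlongrightarrow> 0) (at z0 within S)"
    by (simp add: tendsto_norm_zero_iff)
  then have small: "\<forall>\<^sub>F z in at z0 within S. norm (\<Sum>i\<le>d. coeff (P z) i * x ^ i) < c / 2 * e ^ d"
    using \<open>0 < c\<close> \<open>0 < e\<close> by (intro order_tendstoD) auto
  have "((\<lambda>z. norm (coeff (P z) d)) \<longlongrightarrow> norm (coeff (P z0) d)) (at z0 within S)"
    using cont by (intro tendsto_intros) (auto simp: continuous_within)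
  then have large: "\<forall>\<^sub>F z in at z0 within S. c / 2 < norm (coeff (P z) d)"
    using \<open>0 < c\<close> deg[OF \<open>z0 \<in> S\<close>] by (intro order_tendstoD) (auto simp: c_def)
  show ?thesis
    using inS small large
  proof eventually_elim
    case (elim z)
    show ?case
    proof (rule ccontr)
      assume "\<not> ?thesis"
      then have "norm (lead_coeff (P z)) * e ^ degree (P z) \<le> norm (poly (P z) x)"
        using \<open>0 < e\<close> by (intro norm_poly_ge_if_no_near_root) (auto simp: not_less)
      moreover have "c / 2 * e ^ d < norm (coeff (P z) d) * e ^ d"
        using elim \<open>0 < e\<close> by simp
      ultimately show False
        using elim deg[of z] by (simp add: poly_eq_sum_upto[of _ d])
    qed
  qed
qed

lemma card_roots_rsquarefree:
  fixes p :: "complex poly"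
  assumes "rsquarefree p"
  shows "card {x. poly p x = 0} = degree p"
proof -
  have "p \<noteq> 0" using assms by (auto simp: rsquarefree_def)
  have "degree p = degree (Polynomial.smult (lead_coeff p) (\<Prod>z|poly p z = 0. [:-z, 1:]))"
    by (simp add: complex_poly_decompose_rsquarefree[OF assms])
  also have "\<dots> = card {x. poly p x = 0}"
    using \<open>p \<noteq> 0\<close> by (simp add: degree_prod_sum_eq)
  finally show ?thesis by simp
qed

lemma finite_set_separated:
  fixes X :: "'a::metric_space set"
  assumes "finite X"
  obtains e where "0 < e" "\<And>x y. x \<in> X \<Longrightarrow> y \<in> X \<Longrightarrow> x \<noteq> y \<Longrightarrow> ball x e \<inter> ball y e = {}"
proof -
  define D where "D = (\<lambda>(x,y). dist x y) ` {(x,y) \<in> X \<times> X. x \<noteq> y}"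
  have "finite D" unfolding D_def
    by (intro finite_imageI finite_subset[OF _ finite_cartesian_product[OF assms assms]]) auto
  define e where "e = Min (insert 1 D) / 2"
  have "0 < e"
    using \<open>finite D\<close> by (auto simp: e_def D_def)
  moreover have "ball x e \<inter> ball y e = {}" if "x \<in> X" "y \<in> X" "x \<noteq> y" for x y
  proof -
    have "dist x y \<in> D" using that by (force simp: D_def)
    then have "2 * e \<le> dist x y"
      using \<open>finite D\<close> by (simp add: e_def)
    show ?thesis
    proof (rule ccontr)
      assume "\<not> ?thesis"
      then obtain w where "dist x w < e" "dist y w < e" by auto
      then have "dist x y < 2 * e" using dist_triangle2[of x y w] by linarith
      then show False using \<open>2 * e \<le> dist x y\<close> by simp
    qed
  qed
  ultimately show ?thesis using that by blast
qed

section \<open>Holomorphic root branches of a family without multiple roots\<close>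

text \<open>A holomorphic family of polynomials of constant degree without multiple roots over a convex domain,
hence over a simply connected one. The constant number of roots is what makes the roots a covering.\<close>

locale separable_family =
  fixes P :: "complex \<Rightarrow> complex poly" and \<Omega> :: "complex set" and d :: nat
  assumes open_dom: "open \<Omega>" and convex_dom: "convex \<Omega>"
    and holo: "\<And>k. (\<lambda>z. coeff (P z) k) holomorphic_on \<Omega>"
    and deg: "\<And>z. z \<in> \<Omega> \<Longrightarrow> degree (P z) = d" and deg_pos: "0 < d"
    and sqf: "\<And>z. z \<in> \<Omega> \<Longrightarrow> rsquarefree (P z)"
begin

definition curve :: "(complex \<times> complex) set" where
  "curve = {(z, x). z \<in> \<Omega> \<and> poly (P z) x = 0}"

lemma card_roots: "z \<in> \<Omega> \<Longrightarrow> card {x. poly (P z) x = 0} = d"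
  using card_roots_rsquarefree[OF sqf] deg by auto

lemma nonzero: "z \<in> \<Omega> \<Longrightarrow> P z \<noteq> 0"
  using deg deg_pos by force

lemma root_near:
  assumes "z0 \<in> \<Omega>" "poly (P z0) x = 0" "0 < e"
  shows "\<exists>h>0. ball z0 h \<subseteq> \<Omega> \<and> (\<forall>z\<in>ball z0 h. \<exists>y\<in>ball x e. poly (P z) y = 0)"
proof -
  have "\<forall>\<^sub>F z in at z0 within \<Omega>. \<exists>y\<in>ball x e. poly (P z) y = 0"
  proof (rule eventually_root_near[OF _ deg deg_pos])
    show "continuous (at z0 within \<Omega>) (\<lambda>z. coeff (P z) k)" for k
      using holo holomorphic_on_imp_continuous_on assms(1) continuous_on_eq_continuous_within by blast
  qed (use assms in auto)
  then obtain h where h: "h > 0" "\<And>z. z \<in> \<Omega> \<Longrightarrow> z \<noteq> z0 \<Longrightarrow> dist z z0 < h \<Longrightarrow> \<exists>y\<in>ball x e. poly (P z) y = 0"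
    unfolding eventually_at by blast
  obtain h' where h': "h' > 0" "ball z0 h' \<subseteq> \<Omega>"
    using open_dom assms(1) openE by blast
  show ?thesis
  proof (intro exI[of _ "min h h'"] conjI ballI)
    fix z assume "z \<in> ball z0 (min h h')"
    then have "z \<in> \<Omega>" "dist z z0 < h" using h' by (auto simp: dist_commute)
    then show "\<exists>y\<in>ball x e. poly (P z) y = 0"
      using h(2)[of z] assms by (cases "z = z0") auto
  qed (use h h' in auto)
qed

text \<open>Since the number of roots is constant, each of the small discs about the roots at one point
  contains exactly one root at every nearby point.\<close>

lemma locally_one_root_per_disc:
  assumes "z0 \<in> \<Omega>" "0 < e"
    and disj: "\<And>x y. poly (P z0) x = 0 \<Longrightarrow> poly (P z0) y = 0 \<Longrightarrow> x \<noteq> y \<Longrightarrow> ball x e \<inter> ball y e = {}"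
  obtains h where "0 < h" "ball z0 h \<subseteq> \<Omega>"
    "\<And>z x. z \<in> ball z0 h \<Longrightarrow> poly (P z0) x = 0 \<Longrightarrow> \<exists>!y. y \<in> ball x e \<and> poly (P z) y = 0"
    "\<And>z y. z \<in> ball z0 h \<Longrightarrow> poly (P z) y = 0 \<Longrightarrow> \<exists>x. poly (P z0) x = 0 \<and> y \<in> ball x e"
proof -
  define X where "X = {x. poly (P z0) x = 0}"
  have finX: "finite X" unfolding X_def using poly_roots_finite nonzero assms(1) by blast
  have "\<forall>x\<in>X. \<exists>h>0. ball z0 h \<subseteq> \<Omega> \<and> (\<forall>z\<in>ball z0 h. \<exists>y\<in>ball x e. poly (P z) y = 0)"
    using root_near assms X_def by blast
  then obtain h where h: "\<And>x. x \<in> X \<Longrightarrow> h x > 0" "\<And>x. x \<in> X \<Longrightarrow> ball z0 (h x) \<subseteq> \<Omega>"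
     "\<And>x z. x \<in> X \<Longrightarrow> z \<in> ball z0 (h x) \<Longrightarrow> \<exists>y\<in>ball x e. poly (P z) y = 0"
    by metis
  have "X \<noteq> {}" using card_roots[OF assms(1)] deg_pos by (metis X_def card.empty less_irrefl)
  define h0 where "h0 = Min (h ` X)"
  have h0: "0 < h0" "ball z0 h0 \<subseteq> \<Omega>"
     "\<And>x z. x \<in> X \<Longrightarrow> z \<in> ball z0 h0 \<Longrightarrow> \<exists>y\<in>ball x e. poly (P z) y = 0"
  proof -
    show "0 < h0" using finX \<open>X \<noteq> {}\<close> h(1) by (simp add: h0_def)
    have le: "h0 \<le> h x" if "x \<in> X" for x using finX that by (simp add: h0_def)
    show "ball z0 h0 \<subseteq> \<Omega>" using \<open>X \<noteq> {}\<close> le h(2) by (meson ex_in_conv subset_ball subset_trans)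
    show "\<exists>y\<in>ball x e. poly (P z) y = 0" if "x \<in> X" "z \<in> ball z0 h0" for x z
      using h(3)[of x z] that le[of x] by auto
  qed
  \<comment> \<open>each disc contains at least one root and the number of roots is constant, so there is exactly one root per disc\<close>
  have main: "\<exists>f. bij_betw f X {y. poly (P z) y = 0} \<and> (\<forall>x\<in>X. f x \<in> ball x e)" if z: "z \<in> ball z0 h0" for z
  proof -
    from h0(3)[OF _ z] obtain f where f: "\<And>x. x \<in> X \<Longrightarrow> f x \<in> ball x e" "\<And>x. x \<in> X \<Longrightarrow> poly (P z) (f x) = 0"
      by metis
    have inj: "inj_on f X"
    proof (rule inj_onI, rule ccontr)
      fix x y assume "x \<in> X" "y \<in> X" "f x = f y" "x \<noteq> y"
      then show False using f(1)[of x] f(1)[of y] disj[of x y] by (auto simp: X_def)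
    qed
    have "z \<in> \<Omega>" using z h0 by auto
    have "f ` X = {y. poly (P z) y = 0}"
    proof (rule card_subset_eq)
      show "finite {y. poly (P z) y = 0}" using poly_roots_finite nonzero[OF \<open>z \<in> \<Omega>\<close>] by blast
      show "card (f ` X) = card {y. poly (P z) y = 0}"
        using card_image[OF inj] card_roots[OF \<open>z \<in> \<Omega>\<close>] card_roots[OF assms(1)] by (simp add: X_def)
    qed (use f in auto)
    then show ?thesis using inj f(1) by (auto simp: bij_betw_def)
  qed
  show ?thesis
  proof (rule that[OF h0(1,2)])
    fix z x assume z: "z \<in> ball z0 h0" and x: "poly (P z0) x = 0"
    obtain f where f: "bij_betw f X {y. poly (P z) y = 0}" "\<And>x. x \<in> X \<Longrightarrow> f x \<in> ball x e"
      using main[OF z] by blast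
    show "\<exists>!y. y \<in> ball x e \<and> poly (P z) y = 0"
    proof (rule ex1I[of _ "f x"])
      show "f x \<in> ball x e \<and> poly (P z) (f x) = 0"
        using f x unfolding bij_betw_def X_def by blast
      fix y assume y: "y \<in> ball x e \<and> poly (P z) y = 0"
      then obtain x' where x': "x' \<in> X" "y = f x'" using f unfolding bij_betw_def by blast
      then have "y \<in> ball x' e" using f by auto
      then have "x' = x" using y disj[of x x'] x x'(1) by (auto simp: X_def disjoint_iff)
      then show "y = f x" using x' by simp
    qed
  next
    fix z y assume z: "z \<in> ball z0 h0" and y: "poly (P z) y = 0"
    obtain f where f: "bij_betw f X {y. poly (P z) y = 0}" "\<And>x. x \<in> X \<Longrightarrow> f x \<in> ball x e"
      using main[OF z] by blast
    from y have "y \<in> f ` X" using f(1) by (simp add: bij_betw_def)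
    then show "\<exists>x. poly (P z0) x = 0 \<and> y \<in> ball x e"
      using f(2) by (auto simp: X_def)
  qed
qed

text \<open>Over a small disc around a point, the sheets are the parts of the curve that lie in the small discs
about the roots at this point; each sheet is the graph of a continuous function.\<close>

lemma covering_curve: "covering_space curve fst \<Omega>"
proof
  show "continuous_on curve fst" by (intro continuous_intros)
  show "fst ` curve = \<Omega>"
  proof (intro equalityI subsetI)
    fix z assume "z \<in> \<Omega>"
    then have "{x. poly (P z) x = 0} \<noteq> {}" using card_roots deg_pos by fastforce
    then show "z \<in> fst ` curve" using \<open>z \<in> \<Omega>\<close> by (force simp: curve_def image_iff)
  qed (auto simp: curve_def)
  fix z0 assume z0: "z0 \<in> \<Omega>"
  have "finite {x. poly (P z0) x = 0}" using poly_roots_finite nonzero z0 by blast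
  then obtain e where e: "0 < e"
    "\<And>x y. poly (P z0) x = 0 \<Longrightarrow> poly (P z0) y = 0 \<Longrightarrow> x \<noteq> y \<Longrightarrow> ball x e \<inter> ball y e = {}"
    by (rule finite_set_separated) auto
  obtain h where h: "0 < h" "ball z0 h \<subseteq> \<Omega>"
    and ex1: "\<And>z x. z \<in> ball z0 h \<Longrightarrow> poly (P z0) x = 0 \<Longrightarrow> \<exists>!y. y \<in> ball x e \<and> poly (P z) y = 0"
    and cover: "\<And>z y. z \<in> ball z0 h \<Longrightarrow> poly (P z) y = 0 \<Longrightarrow> \<exists>x. poly (P z0) x = 0 \<and> y \<in> ball x e"
    by (rule locally_one_root_per_disc[OF z0 e]) blast+
  define V where "V x = curve \<inter> (ball z0 h \<times> ball x e)" for x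
  let ?v = "V ` {x. poly (P z0) x = 0}"
  have "\<Union>?v = curve \<inter> fst -` ball z0 h"
    using cover by (fastforce simp: V_def curve_def)
  moreover have "openin (top_of_set curve) u" if "u \<in> ?v" for u
    using that by (auto simp: V_def intro!: openin_open_Int open_Times)
  moreover have "pairwise disjnt ?v"
  proof (rule pairwiseI)
    fix u u' assume "u \<in> ?v" "u' \<in> ?v" "u \<noteq> u'"
    then obtain x y where xy: "u = V x" "u' = V y" "poly (P z0) x = 0" "poly (P z0) y = 0" "x \<noteq> y"
      by blast
    then show "disjnt u u'" using e(2)[OF xy(3,4,5)] by (auto simp: V_def disjnt_iff)
  qed
  moreover have "\<exists>q. homeomorphism u (ball z0 h) fst q" if u: "u \<in> ?v" for u
  proof -
    obtain x where x: "u = V x" "poly (P z0) x = 0" using u by blast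
    define r where "r z = (THE y. y \<in> ball x e \<and> poly (P z) y = 0)" for z
    have r: "r z \<in> ball x e" "poly (P z) (r z) = 0" if "z \<in> ball z0 h" for z
      using theI'[OF ex1[OF that x(2)]] by (auto simp: r_def)
    have r_unique: "y = r z" if "z \<in> ball z0 h" "y \<in> ball x e" "poly (P z) y = 0" for z y
      using ex1[OF that(1) x(2)] that r[OF that(1)] by blast
    have "continuous_on (ball z0 h) r"
      unfolding continuous_on_iff
    proof (intro ballI allI impI)
      fix z1 :: complex and e' :: real assume z1: "z1 \<in> ball z0 h" and "0 < e'"
      obtain s where s: "0 < s" "ball (r z1) s \<subseteq> ball x e"
        using r[OF z1] open_ball openE by blast
      have "z1 \<in> \<Omega>" using z1 h by auto
      obtain k where k: "k > 0" "\<And>z. z \<in> ball z1 k \<Longrightarrow> \<exists>y\<in>ball (r z1) (min s e'). poly (P z) y = 0"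
        using root_near[OF \<open>z1 \<in> \<Omega>\<close> r(2)[OF z1], of "min s e'"] s \<open>0 < e'\<close> by auto
      show "\<exists>k>0. \<forall>z\<in>ball z0 h. dist z z1 < k \<longrightarrow> dist (r z) (r z1) < e'"
      proof (intro exI[of _ k] conjI ballI impI)
        fix z assume z: "z \<in> ball z0 h" "dist z z1 < k"
        then obtain y where y: "y \<in> ball (r z1) (min s e')" "poly (P z) y = 0"
          using k(2)[of z] by (auto simp: dist_commute)
        then have "y = r z" using r_unique[OF z(1)] s by auto
        then show "dist (r z) (r z1) < e'" using y by (simp add: dist_commute)
      qed (use k in auto)
    qed
    then have cont: "continuous_on (ball z0 h) (\<lambda>z. (z, r z))" by (intro continuous_intros)
    have sec: "(z, r z) \<in> u" if "z \<in> ball z0 h" for z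
      using r[OF that] that h(2) unfolding x(1) V_def curve_def by blast
    have ret: "fst w \<in> ball z0 h \<and> (fst w, r (fst w)) = w" if "w \<in> u" for w
      using that r_unique[of "fst w" "snd w"] unfolding x(1) V_def curve_def by (cases w) auto
    have "homeomorphism u (ball z0 h) fst (\<lambda>z. (z, r z))"
      unfolding homeomorphism_def
    proof (intro conjI ballI cont)
      show "continuous_on u fst" by (intro continuous_intros)
      show "fst ` u = ball z0 h" using sec ret by (metis (no_types, lifting) fst_conv image_subset_iff rev_image_eqI subsetI subset_antisym)
      show "(\<lambda>z. (z, r z)) ` ball z0 h = u" using sec ret by (metis (no_types, lifting) image_eqI image_subset_iff subsetI subset_antisym)
    qed (use ret in auto)
    then show ?thesis by blast
  qed
  ultimately show "\<exists>T. z0 \<in> T \<and> openin (top_of_set \<Omega>) T \<and>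
      (\<exists>v. \<Union>v = curve \<inter> fst -` T \<and> (\<forall>u\<in>v. openin (top_of_set curve) u) \<and>
        pairwise disjnt v \<and> (\<forall>u\<in>v. \<exists>q. homeomorphism u T fst q))"
    using h by (intro exI[of _ "ball z0 h"] conjI exI[of _ ?v]) (auto intro: open_subset)
qed

text \<open>At a simple root $x_0$ at $z_0$ write $P_{z_0}(x) = (x - x_0)\,Q(x)$ with $Q(x_0) \ne 0$. Dividing
$P_{z_0}(r(z)) = P_{z_0}(r(z)) - P_z(r(z))$ by $(z - z_0)\,Q(r(z))$ expresses the difference quotient of
\<open>r\<close> by those of the coefficients.\<close>

lemma continuous_root_holomorphic:
  assumes cont: "continuous_on \<Omega> r" and root: "\<And>z. z \<in> \<Omega> \<Longrightarrow> poly (P z) (r z) = 0"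
  shows "r holomorphic_on \<Omega>"
  unfolding holomorphic_on_def
proof
  fix z0 assume z0: "z0 \<in> \<Omega>"
  define x0 where "x0 = r z0"
  obtain Q where Q: "P z0 = [:-x0, 1:] * Q"
    using root[OF z0] unfolding x0_def poly_eq_0_iff_dvd dvd_def by blast
  have "poly Q x0 \<noteq> 0"
  proof
    assume "poly Q x0 = 0"
    then have "poly (pderiv (P z0)) x0 = 0" "poly (P z0) x0 = 0"
      unfolding Q pderiv_mult by (simp_all add: pderiv_pCons)
    then show False using sqf[OF z0] rsquarefree_roots by blast
  qed
  have rlim: "(r \<longlongrightarrow> x0) (at z0)"
    using cont z0 open_dom continuous_on_eq_continuous_at unfolding x0_def isCont_def by blast
  define L where "L = (\<Sum>k\<le>d. deriv (\<lambda>z. coeff (P z) k) z0 * x0 ^ k)"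
  have "((\<lambda>z. (\<Sum>k\<le>d. (coeff (P z) k - coeff (P z0) k) / (z - z0) * r z ^ k)) \<longlongrightarrow> L) (at z0)"
    unfolding L_def
  proof (intro tendsto_intros rlim)
    fix k
    have "((\<lambda>z. coeff (P z) k) has_field_derivative deriv (\<lambda>z. coeff (P z) k) z0) (at z0)"
      using holo open_dom z0 holomorphic_derivI by blast
    then show "((\<lambda>z. (coeff (P z) k - coeff (P z0) k) / (z - z0)) \<longlongrightarrow> deriv (\<lambda>z. coeff (P z) k) z0) (at z0)"
      by (simp add: has_field_derivative_iff)
  qed
  moreover have "((\<lambda>z. poly Q (r z)) \<longlongrightarrow> poly Q x0) (at z0)"
    by (intro tendsto_intros rlim)
  ultimately have lim: "((\<lambda>z. - (\<Sum>k\<le>d. (coeff (P z) k - coeff (P z0) k) / (z - z0) * r z ^ k) / poly Q (r z)) \<longlongrightarrow> - L / poly Q x0) (at z0)"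
    using \<open>poly Q x0 \<noteq> 0\<close> by (intro tendsto_divide tendsto_minus)
  have "\<forall>\<^sub>F z in at z0. poly Q (r z) \<noteq> 0"
    using \<open>((\<lambda>z. poly Q (r z)) \<longlongrightarrow> poly Q x0) (at z0)\<close> \<open>poly Q x0 \<noteq> 0\<close> tendsto_imp_eventually_ne by blast
  moreover have "\<forall>\<^sub>F z in at z0. z \<in> \<Omega>"
    using open_dom z0 by (simp add: eventually_at_in_open')
  moreover have "\<forall>\<^sub>F z in at z0. z \<noteq> z0" by (simp add: eventually_at_filter)
  ultimately have "\<forall>\<^sub>F z in at z0. - (\<Sum>k\<le>d. (coeff (P z) k - coeff (P z0) k) / (z - z0) * r z ^ k) / poly Q (r z) = (r z - r z0) / (z - z0)"
  proof eventually_elim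
    case (elim z)
    have "(\<Sum>k\<le>d. (coeff (P z) k - coeff (P z0) k) / (z - z0) * r z ^ k) * (z - z0)
        = (\<Sum>k\<le>d. coeff (P z) k * r z ^ k) - (\<Sum>k\<le>d. coeff (P z0) k * r z ^ k)"
      unfolding sum_distrib_right sum_subtractf[symmetric]
      by (intro sum.cong refl) (use elim in \<open>simp add: field_simps\<close>)
    also have "\<dots> = - poly (P z0) (r z)"
      using root[OF elim(2)] deg[OF elim(2)] deg[OF z0] by (simp add: poly_eq_sum_upto[of _ d])
    also have "\<dots> = - ((r z - x0) * poly Q (r z))"
      by (simp add: Q algebra_simps)
    finally show ?case
      using elim by (simp add: x0_def divide_simps)
  qed
  then have "((\<lambda>z. (r z - r z0) / (z - z0)) \<longlongrightarrow> - L / poly Q x0) (at z0)"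
    by (rule Lim_transform_eventually[OF lim])
  then have "(r has_field_derivative (- L / poly Q x0)) (at z0)"
    by (simp add: has_field_derivative_iff)
  then show "r field_differentiable at z0 within \<Omega>"
    using field_differentiable_at_within field_differentiable_def by blast
qed

lemma holomorphic_root_exists:
  obtains r where "r holomorphic_on \<Omega>" "\<And>z. z \<in> \<Omega> \<Longrightarrow> poly (P z) (r z) = 0"
proof -
  obtain g where g: "continuous_on \<Omega> g" "g \<in> \<Omega> \<rightarrow> curve" "\<And>z. z \<in> \<Omega> \<Longrightarrow> fst (g z) = z"
    by (rule covering_space_lift[OF covering_curve, of \<Omega> id])
       (use convex_dom in \<open>auto intro: convex_imp_simply_connected convex_imp_locally_path_connected\<close>)
  have root: "poly (P z) (snd (g z)) = 0" if "z \<in> \<Omega>" for z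
    using g(2,3) that by (fastforce simp: curve_def Pi_iff)
  show ?thesis
    by (rule that[of "\<lambda>z. snd (g z)"])
       (use root g(1) in \<open>auto intro!: continuous_root_holomorphic continuous_intros\<close>)
qed

lemma continuous_root_unique:
  assumes r: "continuous_on \<Omega> r" "\<And>z. z \<in> \<Omega> \<Longrightarrow> poly (P z) (r z) = 0"
    and s: "continuous_on \<Omega> s" "\<And>z. z \<in> \<Omega> \<Longrightarrow> poly (P z) (s z) = 0"
    and eq: "a \<in> \<Omega>" "r a = s a" and z: "z \<in> \<Omega>"
  shows "r z = s z"
proof -
  have "(\<lambda>z. (z, r z)) z = (\<lambda>z. (z, s z)) z"
    by (rule covering_space_lift_unique[OF covering_curve, where f = id and T = \<Omega> and a = a])
       (use assms convex_dom in \<open>auto intro!: continuous_intros convex_connected simp: curve_def\<close>)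
  then show ?thesis by simp
qed

end

section \<open>Boundary values of a root branch and reflection across the real line\<close>

lemma norm_root_le_coeff_sum:
  fixes p :: "complex poly"
  assumes "degree p = n" "lead_coeff p = 1" "poly p x = 0"
  shows "norm x \<le> 1 + (\<Sum>k<n. norm (coeff p k))"
proof (cases "norm x \<le> 1")
  case True
  then show ?thesis by (meson add_increasing2 norm_ge_zero sum_nonneg)
next
  case False
  have "0 < n"
    using assms by (cases n) (auto elim: degree_eq_zeroE)
  have "x ^ n = - (\<Sum>k<n. coeff p k * x ^ k)"
    using assms poly_eq_sum_upto[of p n x] by (simp add: lessThan_Suc_atMost[symmetric] eq_neg_iff_add_eq_0 add.commute)
  then have "norm x ^ n \<le> (\<Sum>k<n. norm (coeff p k * x ^ k))"
    by (metis norm_minus_cancel norm_power norm_sum)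
  also have "\<dots> \<le> (\<Sum>k<n. norm (coeff p k) * norm x ^ (n - 1))"
    using False \<open>0 < n\<close> by (intro sum_mono) (auto simp: norm_mult norm_power intro!: mult_left_mono power_increasing)
  finally have "norm x * norm x ^ (n - 1) \<le> (\<Sum>k<n. norm (coeff p k)) * norm x ^ (n - 1)"
    using \<open>0 < n\<close> by (simp add: sum_distrib_right power_eq_if)
  then have "norm x \<le> (\<Sum>k<n. norm (coeff p k))"
    using zero_less_power[of "norm x" "n - 1"] False by (subst (asm) mult_le_cancel_right_pos) linarith+
  then show ?thesis by simp
qed

text \<open>The values $r(z)$ stay bounded because the polynomials are monic, so $X_{z_0}(r(z))$ tends to $0$ and
$r(z)$ is eventually close to the finite set of roots of $X_{z_0}$. By connectedness it is always the
same root. Roots of $X_{z_0}$ may be multiple.\<close>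

lemma root_tendsto_at_boundary:
  fixes X :: "complex \<Rightarrow> complex poly"
  assumes coeffs: "\<And>k. ((\<lambda>z. coeff (X z) k) \<longlongrightarrow> coeff (X z0) k) (at z0 within S)"
    and deg: "\<And>z. z \<in> insert z0 S \<Longrightarrow> degree (X z) = n"
    and monic: "\<And>z. z \<in> insert z0 S \<Longrightarrow> lead_coeff (X z) = 1"
    and S: "convex S" "z0 \<notin> S" "z0 islimpt S"
    and r: "continuous_on S r" "\<And>z. z \<in> S \<Longrightarrow> poly (X z) (r z) = 0"
  shows "\<exists>x. poly (X z0) x = 0 \<and> (r \<longlongrightarrow> x) (at z0 within S)"
proof -
  define B where "B = 2 + (\<Sum>k<n. norm (coeff (X z0) k))"
  have inS: "\<forall>\<^sub>F z in at z0 within S. z \<in> S"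
    by (simp add: eventually_at_filter)
  have "((\<lambda>z. 1 + (\<Sum>k<n. norm (coeff (X z) k))) \<longlongrightarrow> 1 + (\<Sum>k<n. norm (coeff (X z0) k))) (at z0 within S)"
    by (intro tendsto_intros coeffs)
  then have "\<forall>\<^sub>F z in at z0 within S. 1 + (\<Sum>k<n. norm (coeff (X z) k)) < B"
    by (rule order_tendstoD) (simp add: B_def)
  with inS have bound: "\<forall>\<^sub>F z in at z0 within S. norm (r z) \<le> B"
  proof eventually_elim
    case (elim z)
    then show ?case using norm_root_le_coeff_sum[of "X z" n "r z"] deg monic r(2) by force
  qed
  have "((\<lambda>z. \<Sum>k\<le>n. norm (coeff (X z0) k - coeff (X z) k) * B ^ k) \<longlongrightarrow> (\<Sum>k\<le>n. norm (coeff (X z0) k - coeff (X z0) k) * B ^ k)) (at z0 within S)"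
    by (intro tendsto_intros coeffs)
  then have err: "((\<lambda>z. \<Sum>k\<le>n. norm (coeff (X z0) k - coeff (X z) k) * B ^ k) \<longlongrightarrow> 0) (at z0 within S)"
    by simp
  have near: "\<forall>\<^sub>F z in at z0 within S. \<exists>x. poly (X z0) x = 0 \<and> r z \<in> ball x e" if "0 < e" for e
  proof -
    have "\<forall>\<^sub>F z in at z0 within S. (\<Sum>k\<le>n. norm (coeff (X z0) k - coeff (X z) k) * B ^ k) < e ^ n"
      using err that by (intro order_tendstoD) auto
    with inS bound show ?thesis
    proof eventually_elim
      case (elim z)
      have "poly (X z0) (r z) = poly (X z0) (r z) - poly (X z) (r z)"
        using r(2) elim by simp
      also have "\<dots> = (\<Sum>k\<le>n. (coeff (X z0) k - coeff (X z) k) * r z ^ k)"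
        using deg elim by (simp add: poly_eq_sum_upto[of _ n] algebra_simps sum_subtractf)
      finally have "norm (poly (X z0) (r z)) \<le> (\<Sum>k\<le>n. norm ((coeff (X z0) k - coeff (X z) k) * r z ^ k))"
        by (simp add: norm_sum)
      also have "\<dots> \<le> (\<Sum>k\<le>n. norm (coeff (X z0) k - coeff (X z) k) * B ^ k)"
        using elim by (intro sum_mono) (auto simp: norm_mult norm_power intro!: mult_left_mono power_mono)
      also have "\<dots> < e ^ n" by (rule elim)
      finally have small: "norm (poly (X z0) (r z)) < e ^ n" .
      show ?case
      proof (rule ccontr)
        assume "\<not> ?thesis"
        then have "norm (lead_coeff (X z0)) * e ^ degree (X z0) \<le> norm (poly (X z0) (r z))"
          using that by (intro norm_poly_ge_if_no_near_root) (auto simp: not_less dist_commute)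
        then show False using small deg monic by simp
      qed
    qed
  qed
  have "X z0 \<noteq> 0" using monic[of z0] by auto
  then have fin: "finite {x. poly (X z0) x = 0}" by (rule poly_roots_finite)
  then obtain e where e: "0 < e"
    "\<And>x y. poly (X z0) x = 0 \<Longrightarrow> poly (X z0) y = 0 \<Longrightarrow> x \<noteq> y \<Longrightarrow> ball x e \<inter> ball y e = {}"
    by (rule finite_set_separated) auto
  obtain h where h: "0 < h" "\<And>z. z \<in> S \<Longrightarrow> dist z z0 < h \<Longrightarrow> \<exists>x. poly (X z0) x = 0 \<and> r z \<in> ball x e"
    using near[OF e(1)] S(2) unfolding eventually_at by metis
  \<comment> \<open>the values near the boundary point form a connected subset of a union of disjoint discs\<close>
  have conn: "connected (r ` (S \<inter> ball z0 h))"
    using r(1) S(1) by (intro connected_continuous_image convex_connected convex_Int) (auto intro: continuous_on_subset)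
  obtain z1 where z1: "z1 \<in> S" "dist z1 z0 < h"
    using S(3) h(1) unfolding islimpt_approachable by blast
  obtain x where x: "poly (X z0) x = 0" "r z1 \<in> ball x e" using h(2)[OF z1] by blast
  have in_ball: "r z \<in> ball x e" if z: "z \<in> S" "dist z z0 < h" for z
  proof (rule ccontr)
    assume nin: "r z \<notin> ball x e"
    define U where "U = (\<Union>y\<in>{y. poly (X z0) y = 0 \<and> y \<noteq> x}. ball y e)"
    have "ball x e \<inter> U \<inter> r ` (S \<inter> ball z0 h) = {}"
      using e(2)[OF x(1)] unfolding U_def by blast
    moreover have cover: "r ` (S \<inter> ball z0 h) \<subseteq> ball x e \<union> U"
      using h(2) unfolding U_def by (fastforce simp: dist_commute)
    moreover have "r z \<in> U" using cover nin z by (force simp: dist_commute)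
    moreover have "open U" unfolding U_def by blast
    moreover have "r z \<in> r ` (S \<inter> ball z0 h)" "r z1 \<in> r ` (S \<inter> ball z0 h)"
      using z z1 by (auto simp: dist_commute)
    ultimately show False
      using connectedD[OF conn open_ball \<open>open U\<close>] x(2) by blast
  qed
  have "(r \<longlongrightarrow> x) (at z0 within S)"
  proof (rule tendstoI)
    fix e' :: real assume "0 < e'"
    have "\<forall>\<^sub>F z in at z0 within S. dist z z0 < h"
      using h(1) by (auto simp: eventually_at)
    with inS near[of "min e e'", simplified, OF conjI, OF e(1) \<open>0 < e'\<close>]
    show "\<forall>\<^sub>F z in at z0 within S. dist (r z) x < e'"
    proof eventually_elim
      case (elim z)
      then obtain y where y: "poly (X z0) y = 0" "dist y (r z) < e" "dist y (r z) < e'" by auto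
      have "r z \<in> ball x e" using in_ball elim by auto
      then have "y = x" using e(2)[OF y(1) x(1)] y(2) by (auto simp: disjoint_iff)
      then show ?case using y by (simp add: dist_commute)
    qed
  qed
  then show ?thesis using x by blast
qed

abbreviation strip :: "real \<Rightarrow> complex set" where
  "strip e \<equiv> {z. \<bar>Im z\<bar> < e}"

abbreviation upper_strip :: "real \<Rightarrow> complex set" where
  "upper_strip e \<equiv> {z. 0 < Im z \<and> Im z < e}"

lemma open_strip [simp, intro]: "open (strip e)"
  by (intro open_Collect_less continuous_intros)

lemma open_upper_strip [simp, intro]: "open (upper_strip e)"
  by (intro open_Collect_conj open_Collect_less continuous_intros)

lemma convex_strip [simp, intro]: "convex (strip e)"
proof -
  have "strip e = {z. Im z < e} \<inter> {z. Im z > - e}" by auto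
  then show ?thesis by (simp add: convex_Int convex_halfspace_Im_lt convex_halfspace_Im_gt)
qed

lemma convex_upper_strip [simp, intro]: "convex (upper_strip e)"
proof -
  have "upper_strip e = {z. Im z < e} \<inter> {z. Im z > 0}" by auto
  then show ?thesis by (simp add: convex_Int convex_halfspace_Im_lt convex_halfspace_Im_gt)
qed

lemma real_islimpt_upper_strip:
  assumes "0 < e"
  shows "complex_of_real t islimpt upper_strip e"
  unfolding islimpt_approachable
proof (intro allI impI)
  fix h :: real assume "0 < h"
  define s where "s = min e h / 2"
  have "0 < s" "s < e" "s < h" using assms \<open>0 < h\<close> by (auto simp: s_def)
  then show "\<exists>x'\<in>upper_strip e. x' \<noteq> complex_of_real t \<and> dist x' (complex_of_real t) < h"
    by (intro bexI[of _ "Complex t s"]) (auto simp: dist_complex_def complex_eq_iff cmod_def)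
qed

text \<open>Having a limit at every boundary point already makes the extension by these limits continuous, which
is what the reflection principle asks for.\<close>

lemma holomorphic_extension_across_reals:
  assumes "0 < e" and holo: "r holomorphic_on upper_strip e"
    and lim: "\<And>t. \<exists>x\<in>\<real>. (r \<longlongrightarrow> x) (at (complex_of_real t) within upper_strip e)"
  obtains R where "R holomorphic_on strip e" "\<And>z. z \<in> upper_strip e \<Longrightarrow> R z = r z"
    "\<And>t. R (complex_of_real t) \<in> \<real>"
    "\<And>t. (r \<longlongrightarrow> R (complex_of_real t)) (at (complex_of_real t) within upper_strip e)"
proof -
  from lim obtain b where b: "\<And>t. b t \<in> \<real>" "\<And>t. (r \<longlongrightarrow> b t) (at (complex_of_real t) within upper_strip e)"
    by metis
  define f where "f z = (if 0 < Im z then r z else b (Re z))" for z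
  have nontriv: "at (complex_of_real t) within upper_strip e \<noteq> bot" for t
    using real_islimpt_upper_strip[OF \<open>0 < e\<close>] by (simp add: trivial_limit_within)
  have "continuous_on (strip e \<inter> {z. 0 \<le> Im z}) f"
    unfolding continuous_on_def
  proof
    fix z assume z: "z \<in> strip e \<inter> {z. 0 \<le> Im z}"
    show "(f \<longlongrightarrow> f z) (at z within strip e \<inter> {z. 0 \<le> Im z})"
    proof (cases "0 < Im z")
      case True
      then have zU: "z \<in> upper_strip e" using z by auto
      have "continuous_on (upper_strip e) r" using holo by (rule holomorphic_on_imp_continuous_on)
      then have "(r \<longlongrightarrow> r z) (at z)"
        using zU by (simp add: continuous_on_eq_continuous_at isCont_def)
      moreover have "\<forall>\<^sub>F w in at z. r w = f w"
        using eventually_at_in_open'[OF open_upper_strip zU] by eventually_elim (auto simp: f_def)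
      ultimately have "(f \<longlongrightarrow> r z) (at z)"
        by (rule Lim_transform_eventually)
      then have "(f \<longlongrightarrow> f z) (at z)" using True by (simp add: f_def)
      then show ?thesis by (rule tendsto_within_subset) auto
    next
      case False
      then have zt: "z = complex_of_real (Re z)" "f z = b (Re z)" using z by (auto simp: complex_eq_iff f_def)
      show ?thesis
      proof (rule tendstoI)
        fix \<epsilon> :: real assume "0 < \<epsilon>"
        then have "\<forall>\<^sub>F w in at (complex_of_real (Re z)) within upper_strip e. dist (r w) (b (Re z)) < \<epsilon> / 2"
          using b(2) by (intro tendstoD) auto
        then obtain h where h: "0 < h" "\<And>w. w \<in> upper_strip e \<Longrightarrow> dist w z < h \<Longrightarrow> dist (r w) (f z) < \<epsilon> / 2"
          unfolding eventually_at using zt False by (metis mem_Collect_eq)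
        have "dist (f w) (f z) < \<epsilon>" if w: "w \<in> strip e \<inter> {z. 0 \<le> Im z}" "dist w z < h" for w
        proof (cases "0 < Im w")
          case True
          then show ?thesis using h(2)[of w] w \<open>0 < \<epsilon>\<close> by (auto simp: f_def)
        next
          case False
          then have wt: "w = complex_of_real (Re w)" "f w = b (Re w)" using w by (auto simp: complex_eq_iff f_def)
          have near: "\<forall>\<^sub>F v in at w within upper_strip e. dist v z < h"
          proof -
            have "\<forall>\<^sub>F v in at w. v \<in> ball z h"
              using w(2) by (intro eventually_at_in_open') (auto simp: dist_commute)
            then have "\<forall>\<^sub>F v in at w within upper_strip e. v \<in> ball z h"
              using at_le[of "upper_strip e" UNIV w] filter_leD by blast
            then show ?thesis by (simp add: dist_commute)
          qed
          have inU: "\<forall>\<^sub>F v in at w within upper_strip e. v \<in> upper_strip e"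
            by (simp add: eventually_at_filter)
          have "dist (f w) (f z) \<le> \<epsilon> / 2"
          proof (rule tendsto_upperbound)
            show "((\<lambda>v. dist (r v) (f z)) \<longlongrightarrow> dist (f w) (f z)) (at w within upper_strip e)"
              using b(2)[of "Re w"] wt by (intro tendsto_intros) auto
            show "\<forall>\<^sub>F v in at w within upper_strip e. dist (r v) (f z) \<le> \<epsilon> / 2"
              using near inU by eventually_elim (use h(2) in force)
            show "at w within upper_strip e \<noteq> bot" using nontriv[of "Re w"] wt by simp
          qed
          then show ?thesis using \<open>0 < \<epsilon>\<close> by simp
        qed
        then show "\<forall>\<^sub>F w in at z within strip e \<inter> {z. 0 \<le> Im z}. dist (f w) (f z) < \<epsilon>"
          unfolding eventually_at using h(1) by blast
      qed
    qed
  qed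
  moreover have "f holomorphic_on (strip e \<inter> {z. 0 < Im z})"
    by (rule holomorphic_transform[OF holomorphic_on_subset[OF holo]]) (auto simp: f_def)
  moreover have "f z \<in> \<real>" if "z \<in> \<real>" for z
    using b(1) that by (auto simp: f_def complex_is_Real_iff)
  ultimately have "(\<lambda>z. if 0 \<le> Im z then f z else cnj (f (cnj z))) holomorphic_on strip e"
    by (intro Schwarz_reflection) auto
  then show ?thesis
    by (rule that) (use b in \<open>auto simp: f_def\<close>)
qed

section \<open>The ring of periodic real-analytic functions\<close>

definition line_puiseux :: "(real \<Rightarrow> complex) set" where
  "line_puiseux = {f. \<exists>N>0. \<exists>g. g analytic_on sphere 0 1 \<and> (\<forall>t. f t = g (cis (t / of_nat N)))}"

text \<open>The elements $g(z^{1/N})$ of $\mathcal P(S^1)$ at $z = e^{\mathrm i t}$, continued analytically to all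
real $t$ so that the branch cut of the argument disappears. Such a function determines the germ along
the circle, and equality is equality of functions instead of agreement on some neighbourhood.\<close>

typedef puis = line_puiseux morphisms val Abs_puis
proof
  show "(\<lambda>_. 0) \<in> line_puiseux"
    unfolding line_puiseux_def by (auto intro!: exI[of _ 1] exI[of _ "\<lambda>_. 0"] simp: analytic_on_const)
qed

lemma puis_eqI: "(\<And>t. val f t = val g t) \<Longrightarrow> f = g"
  by (meson ext val_inject)

lemma puis_eq_iff: "f = g \<longleftrightarrow> (\<forall>t. val f t = val g t)"
  using puis_eqI by blast

lemma analytic_power_circle:
  assumes "g analytic_on sphere 0 1"
  shows "(\<lambda>w. g (w ^ M)) analytic_on sphere 0 (1::real)"
proof -
  have "(g \<circ> (\<lambda>w. w ^ M)) analytic_on sphere 0 (1::real)"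
    by (rule analytic_on_compose)
       (use assms in \<open>auto intro!: analytic_intros elim!: analytic_on_subset simp: norm_power\<close>)
  then show ?thesis by (simp add: o_def)
qed

lemma line_puiseux_common:
  assumes "f1 \<in> line_puiseux" "f2 \<in> line_puiseux"
  obtains N g1 g2 where "N > 0" "g1 analytic_on sphere 0 1" "g2 analytic_on sphere 0 1"
    "\<And>t. f1 t = g1 (cis (t / of_nat N))" "\<And>t. f2 t = g2 (cis (t / of_nat N))"
proof -
  from assms obtain N1 h1 N2 h2 where h: "N1 > 0" "h1 analytic_on sphere 0 1" "\<And>t. f1 t = h1 (cis (t / of_nat N1))"
    "N2 > 0" "h2 analytic_on sphere 0 1" "\<And>t. f2 t = h2 (cis (t / of_nat N2))"
    unfolding line_puiseux_def by blast
  have "cis (t / of_nat (N1 * N2)) ^ N2 = cis (t / of_nat N1)"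
       "cis (t / of_nat (N1 * N2)) ^ N1 = cis (t / of_nat N2)" for t
    using h(1,4) by (simp_all add: Complex.DeMoivre)
  then show ?thesis
    using h by (intro that[of "N1 * N2" "\<lambda>w. h1 (w ^ N2)" "\<lambda>w. h2 (w ^ N1)"] analytic_power_circle) auto
qed

lemma line_puiseuxI:
  assumes "N > 0" "g analytic_on sphere 0 1" "\<And>t. f t = g (cis (t / of_nat N))"
  shows "f \<in> line_puiseux"
  using assms unfolding line_puiseux_def by blast

lemma line_puiseux_const: "(\<lambda>_. c) \<in> line_puiseux"
  by (rule line_puiseuxI[of 1 "\<lambda>_. c"]) (auto simp: analytic_on_const)

lemma line_puiseux_uminus:
  assumes "f \<in> line_puiseux" shows "(\<lambda>t. - f t) \<in> line_puiseux"
proof (rule line_puiseux_common[OF assms assms])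
  fix N g assume *: "0 < (N::nat)" "g analytic_on sphere 0 1" "\<And>t. f t = g (cis (t / of_nat N))"
  show ?thesis by (rule line_puiseuxI[of N "\<lambda>w. - g w"]) (use * in \<open>auto intro!: analytic_intros\<close>)
qed

lemma line_puiseux_add:
  assumes "f1 \<in> line_puiseux" "f2 \<in> line_puiseux" shows "(\<lambda>t. f1 t + f2 t) \<in> line_puiseux"
proof (rule line_puiseux_common[OF assms])
  fix N g1 g2 assume *: "0 < (N::nat)" "g1 analytic_on sphere 0 1" "g2 analytic_on sphere 0 1"
    "\<And>t. f1 t = g1 (cis (t / of_nat N))" "\<And>t. f2 t = g2 (cis (t / of_nat N))"
  show ?thesis by (rule line_puiseuxI[of N "\<lambda>w. g1 w + g2 w"]) (use * in \<open>auto intro!: analytic_intros\<close>)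
qed

lemma line_puiseux_mult:
  assumes "f1 \<in> line_puiseux" "f2 \<in> line_puiseux" shows "(\<lambda>t. f1 t * f2 t) \<in> line_puiseux"
proof (rule line_puiseux_common[OF assms])
  fix N g1 g2 assume *: "0 < (N::nat)" "g1 analytic_on sphere 0 1" "g2 analytic_on sphere 0 1"
    "\<And>t. f1 t = g1 (cis (t / of_nat N))" "\<And>t. f2 t = g2 (cis (t / of_nat N))"
  show ?thesis by (rule line_puiseuxI[of N "\<lambda>w. g1 w * g2 w"]) (use * in \<open>auto intro!: analytic_intros\<close>)
qed

lemma analytic_reflect_circle:
  assumes "g analytic_on sphere 0 1"
  shows "(\<lambda>w. cnj (g (inverse (cnj w)))) analytic_on sphere 0 (1::real)"
proof -
  obtain T where T: "open T" "sphere 0 1 \<subseteq> T" "g holomorphic_on T"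
    using assms analytic_on_holomorphic by blast
  have "open (cnj -` T)" using T(1) by (intro open_vimage continuous_intros)
  moreover have "cnj ` (cnj -` T) \<subseteq> T" by auto
  ultimately have "(cnj \<circ> g \<circ> cnj) holomorphic_on (cnj -` T)"
    using T(3) by (intro holomorphic_on_compose_cnj_cnj) (auto elim: holomorphic_on_subset)
  moreover have "sphere 0 1 \<subseteq> cnj -` T" using T(2) by (auto simp: subset_iff)
  ultimately have "(cnj \<circ> g \<circ> cnj) analytic_on sphere 0 1"
    using \<open>open (cnj -` T)\<close> analytic_on_holomorphic by blast
  then have "(cnj \<circ> g \<circ> cnj) analytic_on inverse ` sphere 0 1"
    by (rule analytic_on_subset) (auto simp: norm_inverse)
  moreover have "inverse analytic_on sphere 0 (1::real)"
    by (intro analytic_intros) auto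
  ultimately have "((cnj \<circ> g \<circ> cnj) \<circ> inverse) analytic_on sphere 0 (1::real)"
    by (rule analytic_on_compose[rotated])
  then show ?thesis by (simp add: o_def)
qed

lemma line_puiseux_cnj:
  assumes "f \<in> line_puiseux" shows "(\<lambda>t. cnj (f t)) \<in> line_puiseux"
proof (rule line_puiseux_common[OF assms assms])
  fix N g assume *: "0 < (N::nat)" "g analytic_on sphere 0 1" "\<And>t. f t = g (cis (t / of_nat N))"
  show ?thesis
    by (rule line_puiseuxI[of N "\<lambda>w. cnj (g (inverse (cnj w)))"])
       (use * in \<open>auto intro!: analytic_reflect_circle simp: cis_cnj cis_inverse\<close>)
qed

instantiation puis :: comm_ring_1
begin
definition "0 = Abs_puis (\<lambda>_. 0)"
definition "1 = Abs_puis (\<lambda>_. 1)"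
definition "f + g = Abs_puis (\<lambda>t. val f t + val g t)"
definition "f * g = Abs_puis (\<lambda>t. val f t * val g t)"
definition "- f = Abs_puis (\<lambda>t. - val f t)"
definition "f - g = f + - (g::puis)"

lemma val_0 [simp]: "val 0 t = 0"
  by (simp add: zero_puis_def Abs_puis_inverse line_puiseux_const)
lemma val_1 [simp]: "val 1 t = 1"
  by (simp add: one_puis_def Abs_puis_inverse line_puiseux_const)
lemma val_add [simp]: "val (f + g) t = val f t + val g t"
  by (simp add: plus_puis_def Abs_puis_inverse line_puiseux_add val)
lemma val_mult [simp]: "val (f * g) t = val f t * val g t"
  by (simp add: times_puis_def Abs_puis_inverse line_puiseux_mult val)
lemma val_uminus [simp]: "val (- f) t = - val f t"
  by (simp add: uminus_puis_def Abs_puis_inverse line_puiseux_uminus val)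
lemma val_diff [simp]: "val (f - g) t = val f t - val g t"
  by (simp add: minus_puis_def)

instance
  by standard (auto simp: puis_eq_iff algebra_simps)
end

lemma val_of_nat [simp]: "val (of_nat n) t = of_nat n"
  by (induction n) auto

lemma val_sum: "val (sum f A) t = (\<Sum>x\<in>A. val (f x) t)"
  by (induction A rule: infinite_finite_induct) auto

instance puis :: ring_char_0
proof
  show "inj (of_nat :: nat \<Rightarrow> puis)"
    by (rule injI) (metis val_of_nat of_nat_eq_iff)
qed

instantiation puis :: conjugatable_ring
begin
definition "conjugate f = Abs_puis (\<lambda>t. cnj (val f t))"
lemma val_conjugate [simp]: "val (conjugate f) t = cnj (val f t)"
  by (simp add: conjugate_puis_def Abs_puis_inverse line_puiseux_cnj val)
instance
  by standard (auto simp: puis_eq_iff)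
end

text \<open>On the circle the quotient of the two representing functions is bounded by $1$, also where the
denominator vanishes, since division by zero yields zero. A meromorphic function that is bounded on
an arc through a point has no pole there.\<close>

lemma divides_if_norm_le:
  assumes "\<And>t. norm (val a t) \<le> norm (val c t)"
  shows "\<exists>u. a = c * (u :: puis)"
proof (rule line_puiseux_common[OF val[of a] val[of c]])
  fix N ga gc assume g: "0 < (N::nat)" "ga analytic_on sphere 0 1" "gc analytic_on sphere 0 1"
    "\<And>t. val a t = ga (cis (t / of_nat N))" "\<And>t. val c t = gc (cis (t / of_nat N))"
  have le: "norm (ga w) \<le> norm (gc w)" if "w \<in> sphere 0 1" for w
  proof -
    have "w = cis ((of_nat N * Arg w) / of_nat N)"
      using that g(1) by (cases "w = 0") (simp_all add: cis_Arg sgn_div_norm)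
    then show ?thesis using assms[of "of_nat N * Arg w"] g(4,5) by metis
  qed
  define h where "h w = ga w / gc w" for w
  have mero: "h meromorphic_on sphere 0 1"
    unfolding h_def using g(2,3) by (intro meromorphic_intros analytic_on_imp_meromorphic_on)
  have le1: "norm (h w) \<le> 1" if "w \<in> sphere 0 1" for w
    using le[OF that] by (simp add: h_def norm_divide divide_le_eq_1)
  define q where "q = remove_sings h"
  have "q analytic_on {w}" if w: "w \<in> sphere 0 1" for w
  proof -
    have "\<not> is_pole h w"
    proof
      assume "is_pole h w"
      then have "\<forall>\<^sub>F z in at w. norm (h z) > 1"
        unfolding is_pole_def filterlim_at_infinity_conv_norm_at_top filterlim_at_top_dense by blast
      then obtain S where S: "open S" "w \<in> S" "\<And>z. z \<in> S \<Longrightarrow> z \<noteq> w \<Longrightarrow> norm (h z) > 1"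
        unfolding eventually_at_topological by blast
      \<comment> \<open>the bound holds on the circle only, so the pole is approached along the circle\<close>
      have "w islimpt sphere 0 1"
        using w by (intro connected_imp_perfect) (auto intro!: connected_sphere dest!: arg_cong[where f="\<lambda>A. -1 \<in> A \<and> 1 \<in> A"])
      then obtain z where "z \<in> sphere 0 1" "z \<in> S" "z \<noteq> w"
        using S unfolding islimpt_def by blast
      then show False using S(3) le1 by fastforce
    qed
    moreover have "isolated_singularity_at h w"
      using meromorphic_on_subset[OF mero] w by (intro meromorphic_on_isolated_singularity) auto
    ultimately have "\<not> is_pole q w"
      unfolding q_def by simp
    then show ?thesis
      using remove_sings_nicely_meromorphic[OF mero] w nicely_meromorphic_on_imp_analytic_at
      unfolding q_def by blast
  qed
  then have q: "q analytic_on sphere 0 1"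
    using analytic_on_analytic_at by blast
  define u where "u = Abs_puis (\<lambda>t. q (cis (t / of_nat N)))"
  have u: "val u t = q (cis (t / of_nat N))" for t
    unfolding u_def by (subst Abs_puis_inverse) (use g(1) q in \<open>auto intro: line_puiseuxI\<close>)
  have eq: "ga w = gc w * q w" if w: "w \<in> sphere 0 1" for w
  proof (cases "gc w = 0")
    case True
    then show ?thesis using le[OF w] by simp
  next
    case False
    have "ga analytic_on {w}" "gc analytic_on {w}" using g w by (auto elim: analytic_on_subset)
    then have "h analytic_on {w}"
      unfolding h_def using False by (intro analytic_intros) auto
    then have "q w = h w" unfolding q_def by (rule remove_sings_at_analytic)
    then show ?thesis using False by (simp add: h_def)
  qed
  have "a = c * u"
    by (rule puis_eqI) (simp add: u g eq)
  then show ?thesis by blast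
qed

section \<open>Holomorphic extension to strips\<close>

lemma val_circle_rep:
  obtains N g where "N > 0" "g analytic_on sphere 0 1" "\<And>t. val f t = g (cis (t / of_nat N))"
  using val[of f] unfolding line_puiseux_def by blast

text \<open>The extension is read off from an arbitrary representation on the circle, so that it is defined and
periodic on the whole plane; it is holomorphic only near the real line, and extensions obtained from
different representations agree only there. The value at $0$ is fixed to be zero since coefficientwise
extension of a polynomial must preserve zero coefficients.\<close>

definition ext :: "puis \<Rightarrow> complex \<Rightarrow> complex" where
  "ext f = (if f = 0 then (\<lambda>_. 0) else
     (SOME F. \<exists>N>0. \<exists>g. g analytic_on sphere 0 1 \<and> (\<forall>t. val f t = g (cis (t / of_nat N))) \<and>
        F = (\<lambda>z. g (exp (\<i> * z / of_nat N)))))"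

lemma ext_0 [simp]: "ext 0 z = 0"
  by (simp add: ext_def)

lemma ext_rep:
  obtains N g where "N > 0" "g analytic_on sphere 0 1" "\<And>t. val f t = g (cis (t / of_nat N))"
    "\<And>z. ext f z = g (exp (\<i> * z / of_nat N))"
proof (cases "f = 0")
  case True
  then show ?thesis by (intro that[of 1 "\<lambda>_. 0"]) (auto simp: analytic_on_const)
next
  case False
  have "\<exists>F. \<exists>N>0. \<exists>g. g analytic_on sphere 0 1 \<and> (\<forall>t. val f t = g (cis (t / of_nat N))) \<and>
        F = (\<lambda>z. g (exp (\<i> * z / of_nat N)))"
    using val_circle_rep[of f] by metis
  from someI_ex[OF this] obtain N g where "N > 0" "g analytic_on sphere 0 1"
      "\<forall>t. val f t = g (cis (t / of_nat N))" "ext f = (\<lambda>z. g (exp (\<i> * z / of_nat N)))"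
    using False unfolding ext_def by auto
  then show ?thesis by (intro that[of N g]) auto
qed

lemma ext_of_real [simp]: "ext f (complex_of_real t) = val f t"
proof (rule ext_rep[of f])
  fix N g assume *: "\<And>t. val f t = g (cis (t / of_nat N))" "\<And>z. ext f z = g (exp (\<i> * z / of_nat N))"
  show ?thesis by (simp add: * cis_conv_exp)
qed

lemma ext_periodic:
  obtains N :: nat where "N > 0" "\<And>(z::complex) k. ext f (z + of_nat (k * N) * (2 * pi)) = ext f z"
proof (rule ext_rep[of f])
  fix N g assume *: "0 < (N::nat)" "\<And>z. ext f z = g (exp (\<i> * z / of_nat N))"
  have "exp (\<i> * (z + of_nat (k * N) * (2 * pi)) / of_nat N) = exp (\<i> * z / of_nat N)" for k and z :: complex
  proof -
    have "\<i> * (z + of_nat (k * N) * (2 * pi)) / of_nat N = \<i> * z / of_nat N + of_nat k * (2 * pi * \<i>)"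
      using *(1) by (simp add: field_simps)
    then show ?thesis
      using exp_plus_2pin[of "\<i> * z / of_nat N" "int k"] by (simp add: exp_add exp_of_nat_mult)
  qed
  then show ?thesis using * by (intro that[of N]) auto
qed

text \<open>The filter of strips around the real line: the width of the strip on which an identity between
extensions holds depends on the functions, and the filter hides it.\<close>

definition near_line :: "complex filter" where
  "near_line = filtercomap Im (nhds 0)"

lemma eventually_near_line: "eventually P near_line \<longleftrightarrow> (\<exists>e>0. \<forall>z\<in>strip e. P z)"
  unfolding near_line_def eventually_filtercomap eventually_nhds_metric
proof
  assume "\<exists>Q. (\<exists>d>0. \<forall>x. dist x 0 < d \<longrightarrow> Q x) \<and> (\<forall>x. Q (Im x) \<longrightarrow> P x)"
  then show "\<exists>e>0. \<forall>z\<in>strip e. P z" by (auto simp: dist_real_def)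
next
  assume "\<exists>e>0. \<forall>z\<in>strip e. P z"
  then obtain e where "e > 0" "\<forall>z\<in>strip e. P z" by blast
  then show "\<exists>Q. (\<exists>d>0. \<forall>x. dist x 0 < d \<longrightarrow> Q x) \<and> (\<forall>x. Q (Im x) \<longrightarrow> P x)"
    by (intro exI[of _ "\<lambda>y. \<bar>y\<bar> < e"]) (auto simp: dist_real_def)
qed

definition holo_near_line :: "(complex \<Rightarrow> complex) \<Rightarrow> bool" where
  "holo_near_line F \<longleftrightarrow> (\<exists>e>0. F holomorphic_on strip e)"

lemma holo_near_lineI2:
  assumes "holo_near_line F" "holo_near_line G"
    and "\<And>e. F holomorphic_on strip e \<Longrightarrow> G holomorphic_on strip e \<Longrightarrow> H holomorphic_on strip e"
  shows "holo_near_line H"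
proof -
  from assms obtain e e' where e: "e > 0" "F holomorphic_on strip e" "e' > 0" "G holomorphic_on strip e'"
    unfolding holo_near_line_def by blast
  have "F holomorphic_on strip (min e e')" "G holomorphic_on strip (min e e')"
    using e by (auto elim: holomorphic_on_subset)
  then show ?thesis using e assms(3) unfolding holo_near_line_def by (meson min_less_iff_conj)
qed

lemma holo_near_line_const: "holo_near_line (\<lambda>_. c)"
  unfolding holo_near_line_def by (intro exI[of _ 1]) auto

lemma holo_near_line_add: "holo_near_line F \<Longrightarrow> holo_near_line G \<Longrightarrow> holo_near_line (\<lambda>z. F z + G z)"
  by (erule (1) holo_near_lineI2) (intro holomorphic_intros)

lemma holo_near_line_diff: "holo_near_line F \<Longrightarrow> holo_near_line G \<Longrightarrow> holo_near_line (\<lambda>z. F z - G z)"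
  by (erule (1) holo_near_lineI2) (intro holomorphic_intros)

lemma holo_near_line_mult: "holo_near_line F \<Longrightarrow> holo_near_line G \<Longrightarrow> holo_near_line (\<lambda>z. F z * G z)"
  by (erule (1) holo_near_lineI2) (intro holomorphic_intros)

lemma holo_near_line_sum: "(\<And>i. i \<in> A \<Longrightarrow> holo_near_line (F i)) \<Longrightarrow> holo_near_line (\<lambda>z. \<Sum>i\<in>A. F i z)"
  by (induction A rule: infinite_finite_induct) (auto intro: holo_near_line_const holo_near_line_add)

lemma holo_near_line_cnj:
  assumes "holo_near_line F" shows "holo_near_line (\<lambda>z. cnj (F (cnj z)))"
proof -
  obtain e where e: "e > 0" "F holomorphic_on strip e" using assms holo_near_line_def by blast
  have "(cnj \<circ> F \<circ> cnj) holomorphic_on strip e"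
    by (rule holomorphic_on_compose_cnj_cnj) (auto intro!: holomorphic_on_subset[OF e(2)])
  then show ?thesis using e(1) by (auto simp: holo_near_line_def o_def)
qed

lemma dist_sgn_self:
  assumes "w \<noteq> 0" shows "dist (sgn w) w = \<bar>1 - norm (w :: complex)\<bar>"
proof -
  have "sgn w - w = complex_of_real (1 - norm w) * sgn w"
    using assms by (simp add: sgn_eq field_simps)
  then show ?thesis
    using assms by (simp only: dist_norm norm_mult norm_of_real norm_sgn) simp
qed

lemma holo_near_line_exp:
  assumes *: "0 < (N::nat)" "g analytic_on sphere 0 1"
  shows "holo_near_line (\<lambda>z. g (exp (\<i> * z / of_nat N)))"
proof -
  obtain T where T: "open T" "sphere 0 1 \<subseteq> T" "g holomorphic_on T"
    using *(2) analytic_on_holomorphic by blast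
  obtain h where h: "h > 0" "(\<Union>x\<in>sphere 0 1. ball x h) \<subseteq> T"
    using compact_subset_open_imp_ball_epsilon_subset[OF compact_sphere T(1,2)] by blast
  have "((\<lambda>y::real. exp (- y / of_nat N)) \<longlongrightarrow> exp (- 0 / of_nat N)) (nhds 0)"
    by (intro tendsto_intros filterlim_ident) (use * in auto)
  then have "\<forall>\<^sub>F y in nhds 0. dist (exp (- y / of_nat N)) (1::real) < h"
    using h(1) by (simp add: tendsto_iff)
  then obtain e where e: "e > 0" "\<And>y. \<bar>y\<bar> < e \<Longrightarrow> \<bar>exp (- y / of_nat N) - (1::real)\<bar> < h"
    unfolding eventually_nhds_metric by (auto simp: dist_real_def)
  have "exp (\<i> * z / of_nat N) \<in> T" if "z \<in> strip e" for z
  proof -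
    let ?w = "exp (\<i> * z / of_nat N)"
    have n: "norm ?w = exp (- Im z / of_nat N)" by (simp add: norm_exp_eq_Re)
    have "dist (sgn ?w) ?w = \<bar>1 - norm ?w\<bar>"
      by (rule dist_sgn_self) simp
    then have "dist (sgn ?w) ?w < h"
      using e(2)[of "Im z"] that n by (simp add: abs_minus_commute)
    moreover have "sgn ?w \<in> sphere 0 1" by (simp add: norm_sgn)
    ultimately show ?thesis using h(2) by (meson UN_I mem_ball subset_iff)
  qed
  then have "(g \<circ> (\<lambda>z. exp (\<i> * z / of_nat N))) holomorphic_on strip e"
    using *(1) by (intro holomorphic_on_compose holomorphic_intros) (auto intro!: holomorphic_on_subset[OF T(3)])
  then show ?thesis
    using e(1) by (auto simp: holo_near_line_def o_def)
qed

lemma holo_near_line_ext: "holo_near_line (ext f)"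
proof (rule ext_rep[of f])
  fix N g assume *: "0 < (N::nat)" "g analytic_on sphere 0 1" "\<And>z. ext f z = g (exp (\<i> * z / of_nat N))"
  have "ext f = (\<lambda>z. g (exp (\<i> * z / of_nat N)))" using *(3) by blast
  then show ?thesis using holo_near_line_exp[OF *(1,2)] by simp
qed

lemma zero_on_reals_imp_zero:
  assumes "F holomorphic_on strip e" "a < b" "\<And>t. a < t \<Longrightarrow> t < b \<Longrightarrow> F (complex_of_real t) = 0" "z \<in> strip e"
  shows "F z = 0"
proof -
  have "e > 0" using assms(4) by auto
  define c where "c = (a + b) / 2"
  show ?thesis
  proof (rule analytic_continuation[OF assms(1), of "complex_of_real ` {a<..<b}" "complex_of_real c"])
    show "complex_of_real c islimpt complex_of_real ` {a<..<b}"
      unfolding islimpt_approachable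
    proof (intro allI impI)
      fix h :: real assume "0 < h"
      define s where "s = min h ((b - a) / 2) / 2"
      have s: "0 < s" "s < h" "s < (b - a) / 2" using \<open>0 < h\<close> assms(2) by (auto simp: s_def min_def)
      then have "complex_of_real (c + s) \<in> complex_of_real ` {a<..<b}"
        by (intro imageI) (auto simp: c_def field_simps)
      moreover have "dist (complex_of_real (c + s)) (complex_of_real c) < h"
        using s unfolding dist_of_real by (simp add: dist_real_def)
      ultimately show "\<exists>x'\<in>complex_of_real ` {a<..<b}. x' \<noteq> complex_of_real c \<and> dist x' (complex_of_real c) < h"
        using s by (intro bexI[of _ "complex_of_real (c + s)"]) auto
    qed
  qed (use assms \<open>e > 0\<close> in \<open>auto intro: convex_connected\<close>)
qed

text \<open>This identity theorem is the reason why every algebraic identity in the ring holds for the extensions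
on some strip.\<close>

lemma near_line_identity:
  assumes "holo_near_line F" "holo_near_line G" "\<And>t. F (complex_of_real t) = G (complex_of_real t)"
  shows "\<forall>\<^sub>F z in near_line. F z = G z"
proof -
  obtain e where e: "e > 0" "(\<lambda>z. F z - G z) holomorphic_on strip e"
    using holo_near_line_diff[OF assms(1,2)] holo_near_line_def by blast
  have "F z = G z" if "z \<in> strip e" for z
    using zero_on_reals_imp_zero[OF e(2), of 0 1 z] that assms(3) by simp
  then show ?thesis using e(1) eventually_near_line by blast
qed

lemma ext_add: "\<forall>\<^sub>F z in near_line. ext (f + g) z = ext f z + ext g z"
  by (intro near_line_identity holo_near_line_ext holo_near_line_add) simp

lemma ext_conjugate: "\<forall>\<^sub>F z in near_line. ext (conjugate f) z = cnj (ext f (cnj z))"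
  by (intro near_line_identity holo_near_line_ext holo_near_line_cnj) simp

lemma ext_1: "\<forall>\<^sub>F z in near_line. ext 1 z = 1"
  by (intro near_line_identity holo_near_line_ext holo_near_line_const) simp

lemma ext_of_nat_mult: "\<forall>\<^sub>F z in near_line. ext (of_nat n * f) z = of_nat n * ext f z"
  by (intro near_line_identity holo_near_line_ext holo_near_line_mult holo_near_line_const) simp

lemma ext_sum_mult:
  "\<forall>\<^sub>F z in near_line. ext (\<Sum>i\<in>A. f i * g i) z = (\<Sum>i\<in>A. ext (f i) z * ext (g i) z)"
  by (intro near_line_identity holo_near_line_ext holo_near_line_mult holo_near_line_sum) (simp add: val_sum)

instance puis :: idom
proof
  fix f g :: puis assume "f \<noteq> 0" "g \<noteq> 0"
  show "f * g \<noteq> 0"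
  proof
    assume fg: "f * g = 0"
    obtain t0 where t0: "val f t0 \<noteq> 0" using \<open>f \<noteq> 0\<close> by (auto simp: puis_eq_iff)
    obtain e where e: "e > 0" "ext f holomorphic_on strip e"
      using holo_near_line_ext holo_near_line_def by blast
    obtain e' where e': "e' > 0" "ext g holomorphic_on strip e'"
      using holo_near_line_ext holo_near_line_def by blast
    have "complex_of_real t0 \<in> strip e" using e by simp
    then have "isCont (ext f) (complex_of_real t0)"
      using e holomorphic_on_imp_continuous_on continuous_on_eq_continuous_at open_strip by blast
    then obtain h where h: "h > 0" "\<And>z. dist z (complex_of_real t0) < h \<Longrightarrow> ext f z \<noteq> 0"
      using t0 continuous_at_avoid[of "complex_of_real t0" "ext f" 0] by (auto simp: dist_commute)
    have "val g t = 0" if "t0 < t" "t < t0 + h" for t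
    proof -
      have "val f t \<noteq> 0" using h(2)[of "complex_of_real t"] that by (simp add: dist_of_real dist_real_def)
      moreover have "val f t * val g t = 0" using fg by (metis val_0 val_mult)
      ultimately show ?thesis by simp
    qed
    then have "ext g z = 0" if "z \<in> strip e'" for z
      using zero_on_reals_imp_zero[OF e'(2), of t0 "t0 + h" z] that h(1) by simp
    then have "ext g (complex_of_real t) = 0" for t using e'(1) by (simp del: ext_of_real)
    then have "val g t = 0" for t by simp
    then show False using \<open>g \<noteq> 0\<close> by (simp add: puis_eq_iff)
  qed
qed

text \<open>Zeros are isolated and the extension is periodic, so in a thin strip all zeros lie on the real line
itself.\<close>

lemma ext_nonzero_off_line:
  assumes "f \<noteq> 0"
  shows "\<forall>\<^sub>F z in near_line. Im z \<noteq> 0 \<longrightarrow> ext f z \<noteq> 0"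
proof -
  obtain e where e: "e > 0" "ext f holomorphic_on strip e"
    using holo_near_line_ext holo_near_line_def by blast
  obtain N where N: "N > 0" "\<And>(z::complex) k. ext f (z + of_nat (k * N) * (2 * pi)) = ext f z"
    by (rule ext_periodic[of f]) blast
  obtain t0 where t0: "val f t0 \<noteq> 0" using assms by (auto simp: puis_eq_iff)
  show ?thesis
  proof (cases "ext f constant_on strip e")
    case True
    then obtain c where c: "\<And>z. z \<in> strip e \<Longrightarrow> ext f z = c" by (auto simp: constant_on_def)
    then have "c \<noteq> 0" using t0 c[of "complex_of_real t0"] e(1) by simp
    then show ?thesis using c e(1) unfolding eventually_near_line by blast
  next
    case False
    \<comment> \<open>one period of the strip; its zeros are finite in number\<close>
    define K where "K = cbox (Complex 0 (- e / 2)) (Complex (N * (2 * pi)) (e / 2))"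
    define Z where "Z = {z \<in> K. ext f z = 0}"
    have "finite Z"
      unfolding Z_def
    proof (rule holomorphic_compact_finite_zeros[OF e(2)])
      show "K \<subseteq> strip e" using e(1) by (auto simp: K_def in_cbox_complex_iff)
    qed (use False in \<open>auto simp: K_def intro: convex_connected\<close>)
    define d where "d = Min (insert (e / 2) ((\<lambda>z. \<bar>Im z\<bar>) ` {z \<in> Z. Im z \<noteq> 0}))"
    have "d > 0" using \<open>finite Z\<close> e(1) by (auto simp: d_def)
    have "d \<le> e / 2" unfolding d_def using \<open>finite Z\<close> by (intro Min_le) auto
    have d_le: "d \<le> \<bar>Im z\<bar>" if "z \<in> Z" "Im z \<noteq> 0" for z
      using \<open>finite Z\<close> that by (auto simp: d_def intro!: Min_le)
    have "ext f w \<noteq> 0" if w: "w \<in> strip d" "Im w \<noteq> 0" for w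
    proof
      assume "ext f w = 0"
      define T where "T = real N * (2 * pi)"
      have "T > 0" using N(1) by (simp add: T_def)
      define q where "q = \<lfloor>Re w / T\<rfloor>"
      define v where "v = w - of_real (of_int q * T)"
      have q: "of_int q * T \<le> Re w" "Re w \<le> (of_int q + 1) * T"
        using \<open>T > 0\<close> floor_divide_lower[of T "Re w"] floor_divide_upper[of T "Re w"]
        by (auto simp: q_def)
      have "ext f v = ext f w"
      proof (cases "q \<ge> 0")
        case True
        then have w_eq: "w = v + of_nat (nat q * N) * (2 * pi)"
          by (simp add: v_def T_def)
        have "ext f w = ext f v" by (subst w_eq) (rule N(2))
        then show ?thesis by (rule sym)
      next
        case False
        then have v_eq: "v = w + of_nat (nat (- q) * N) * (2 * pi)"
          by (simp add: v_def T_def)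
        show ?thesis by (subst v_eq) (rule N(2))
      qed
      moreover have "v \<in> K"
        using q w(1) \<open>d \<le> e / 2\<close> unfolding K_def v_def by (auto simp: in_cbox_complex_iff T_def algebra_simps)
      ultimately have "v \<in> Z" using \<open>ext f w = 0\<close> by (simp add: Z_def)
      then show False using d_le[of v] w by (simp add: v_def)
    qed
    then show ?thesis using \<open>d > 0\<close> unfolding eventually_near_line by blast
  qed
qed

section \<open>Real-rooted polynomials have a root in the ring\<close>

text \<open>The function on the circle is $w \mapsto F(-\mathrm i N \log w)$. Different branches of the logarithm
change the argument of \<open>F\<close> by a multiple of the period, so near each point of the circle a branch
that is analytic there may be used.\<close>

lemma periodic_strip_function_is_val:
  assumes holo: "F holomorphic_on strip e" and "0 < e" "0 < (N::nat)"
    and per: "\<And>z. z \<in> strip e \<Longrightarrow> F (z + of_nat N * (2 * pi)) = F z"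
  obtains f where "\<And>t. val f t = F (complex_of_real t)"
proof -
  define T :: complex where "T = of_nat N * (2 * pi)"
  have per_int: "F (z + of_int k * T) = F z" if "z \<in> strip e" for z k
  proof (induction k rule: int_induct[of _ 0])
    case (step1 k)
    have "z + of_int k * T \<in> strip e" using that by (simp add: T_def)
    from per[OF this] have "F (z + of_int k * T + T) = F (z + of_int k * T)" by (simp only: T_def)
    moreover have "z + of_int (k + 1) * T = z + of_int k * T + T" by (simp add: distrib_right)
    ultimately show ?case using step1 by (simp only:)
  next
    case (step2 k)
    have "z + of_int (k - 1) * T \<in> strip e" using that by (simp add: T_def)
    from per[OF this] have "F (z + of_int (k - 1) * T + T) = F (z + of_int (k - 1) * T)" by (simp only: T_def)
    moreover have "z + of_int (k - 1) * T + T = z + of_int k * T" by (simp add: left_diff_distrib)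
    ultimately show ?case using step2 by (simp only:)
  qed simp
  have exp_cong: "F (- \<i> * of_nat N * u) = F (- \<i> * of_nat N * v)"
    if uv: "exp u = exp v" "- \<i> * of_nat N * v \<in> strip e" for u v
  proof -
    obtain k :: int where "u = v + (of_int (2 * k) * pi) * \<i>"
      using uv(1) unfolding exp_eq by blast
    then have "- \<i> * of_nat N * u = - \<i> * of_nat N * v + of_int k * T"
      by (simp add: T_def distrib_left)
    then show ?thesis using per_int[OF uv(2), of k] by (simp only:)
  qed
  define g where "g w = F (- \<i> * of_nat N * Ln w)" for w
  have "g analytic_on {w0}" if w0: "w0 \<in> sphere 0 1" for w0
  proof -
    have "w0 \<noteq> 0" using w0 by auto
    define L where "L w = - \<i> * of_nat N * (Ln w0 + Ln (w / w0))" for w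
    have "Im (L w0) = 0" using w0 \<open>w0 \<noteq> 0\<close> by (simp add: L_def)
    have L: "L analytic_on {w0}"
      unfolding L_def using \<open>w0 \<noteq> 0\<close> by (intro analytic_intros) auto
    have "F analytic_on strip e" using holo by (simp add: analytic_on_open)
    then have "(F \<circ> L) analytic_on {w0}"
      using \<open>Im (L w0) = 0\<close> \<open>0 < e\<close>
      by (intro analytic_on_compose[OF L]) (auto elim: analytic_on_subset)
    moreover have "\<forall>\<^sub>F w in nhds w0. (F \<circ> L) w = g w"
    proof -
      have "isCont L w0" using L by (rule analytic_at_imp_isCont)
      then have "((\<lambda>w. Im (L w)) \<longlongrightarrow> Im (L w0)) (nhds w0)"
        unfolding isCont_def by (intro tendsto_intros) (auto simp: tendsto_at_iff_tendsto_nhds)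
      then have "\<forall>\<^sub>F w in nhds w0. dist (Im (L w)) 0 < e"
        using \<open>0 < e\<close> unfolding tendsto_iff \<open>Im (L w0) = 0\<close> by blast
      moreover have "\<forall>\<^sub>F w in nhds w0. w \<noteq> 0"
        using \<open>w0 \<noteq> 0\<close> by (rule t1_space_nhds)
      ultimately show ?thesis
      proof eventually_elim
        case (elim w)
        have "exp (Ln w) = exp (Ln w0 + Ln (w / w0))"
          using elim \<open>w0 \<noteq> 0\<close> by (simp add: exp_add)
        then show ?case
          unfolding g_def using elim by (subst exp_cong[of _ "Ln w0 + Ln (w / w0)"]) (auto simp: L_def)
      qed
    qed
    ultimately show ?thesis using analytic_at_cong by blast
  qed
  then have g: "g analytic_on sphere 0 1" using analytic_on_analytic_at by blast
  have "g (cis (t / of_nat N)) = F (complex_of_real t)" for t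
  proof -
    have "exp (Ln (cis (t / of_nat N))) = exp (\<i> * of_real (t / of_nat N))"
      by (simp add: cis_conv_exp)
    from exp_cong[OF this] show ?thesis
      using assms(2,3) by (simp add: g_def)
  qed
  then have "(\<lambda>t. F (complex_of_real t)) \<in> line_puiseux"
    using g assms(3) by (intro line_puiseuxI[of N g]) auto
  then show ?thesis
    by (intro that[of "Abs_puis (\<lambda>t. F (complex_of_real t))"]) (simp add: Abs_puis_inverse)
qed

text \<open>Up to scalars this is the statement that an irreducible factor over the field of fractions is coprime
to its derivative in characteristic zero. Taking \<open>P\<close> of minimal degree among the nonconstant divisors
of scalar multiples of \<open>X\<close>, and then a combination of \<open>P\<close> and its derivative of minimal degree,
avoids the field of fractions; pseudo-division replaces division.\<close>

lemma separable_divisor: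
  fixes X :: "'a::{idom, ring_char_0} poly"
  assumes "0 < degree X"
  obtains P E A B e D where "0 < degree P" "e \<noteq> 0" "D \<noteq> 0" "[:e:] * X = P * E"
    "A * P + B * pderiv P = [:D:]"
proof -
  \<comment> \<open>the minimal divisor is irreducible over the field of fractions\<close>
  define S where "S = {P. 0 < degree P \<and> (\<exists>e. e \<noteq> 0 \<and> P dvd [:e:] * X)}"
  have "X \<in> S" using assms by (auto simp: S_def intro!: exI[of _ 1])
  then obtain P where P: "P \<in> S" "\<And>Q. Q \<in> S \<Longrightarrow> degree P \<le> degree Q"
    using ex_has_least_nat[of "\<lambda>P. P \<in> S" X degree] by blast
  then have degP: "0 < degree P" by (simp add: S_def)
  \<comment> \<open>the ideal generated by P and its derivative: a minimal element divides a scalar multiple of P\<close>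
  define J where "J = {G. G \<noteq> 0 \<and> (\<exists>A B. G = A * P + B * pderiv P)}"
  have "pderiv P \<noteq> 0" using degP by (metis less_irrefl pderiv_eq_0_iff)
  moreover have "pderiv P = 0 * P + 1 * pderiv P" by simp
  ultimately have "pderiv P \<in> J" unfolding J_def by blast
  then obtain G where G: "G \<in> J" "\<And>H. H \<in> J \<Longrightarrow> degree G \<le> degree H"
    using ex_has_least_nat[of "\<lambda>G. G \<in> J" "pderiv P" degree] by blast
  then obtain A B where AB: "G \<noteq> 0" "G = A * P + B * pderiv P" by (auto simp: J_def)
  obtain a q where aq: "a \<noteq> 0" "Polynomial.smult a P = G * q + pseudo_mod P G"
    using pseudo_mod(1)[OF AB(1)] by blast
  have "pseudo_mod P G = 0"
  proof (rule ccontr)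
    assume nz: "pseudo_mod P G \<noteq> 0"
    have "pseudo_mod P G = [:a:] * P - G * q" using aq(2) by simp
    also have "\<dots> = ([:a:] - A * q) * P + (- B * q) * pderiv P"
      unfolding AB(2) by (simp add: algebra_simps)
    finally have "pseudo_mod P G \<in> J" using nz unfolding J_def by blast
    then show False using G(2) pseudo_mod(2)[OF AB(1), of P] nz by fastforce
  qed
  then have "G dvd [:a:] * P" using aq(2) by simp
  obtain e where e: "e \<noteq> 0" "P dvd [:e:] * X" using P(1) by (auto simp: S_def)
  have "[:a:] * P dvd [:a * e:] * X"
    using mult_dvd_mono[OF dvd_refl[of "[:a:]"] e(2)] by (simp add: algebra_simps)
  with \<open>G dvd [:a:] * P\<close> have "G dvd [:a * e:] * X" by (rule dvd_trans)
  have "degree G = 0"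
  proof (rule ccontr)
    assume "degree G \<noteq> 0"
    then have "G \<in> S" using \<open>G dvd [:a * e:] * X\<close> aq(1) e(1) by (auto simp: S_def intro!: exI[of _ "a * e"])
    then have "degree P \<le> degree G" by (rule P(2))
    also have "\<dots> \<le> degree (pderiv P)" using G(2) \<open>pderiv P \<in> J\<close> by blast
    also have "\<dots> < degree P" using degP by (simp add: degree_pderiv)
    finally show False by simp
  qed
  then obtain D where "G = [:D:]" by (rule degree_eq_zeroE)
  moreover obtain E where "[:e:] * X = P * E" using e(2) by (auto elim: dvdE)
  ultimately show ?thesis using that degP e(1) AB by auto
qed

definition poly_at :: "complex \<Rightarrow> puis poly \<Rightarrow> complex poly" where
  "poly_at z p = map_poly (\<lambda>f. ext f z) p"

lemma coeff_poly_at [simp]: "coeff (poly_at z p) k = ext (coeff p k) z"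
  by (simp add: poly_at_def coeff_map_poly)

lemma degree_poly_at_le: "degree (poly_at z p) \<le> degree p"
  by (rule degree_le) (simp add: coeff_eq_0)

lemma poly_at_const: "poly_at z [:c:] = [:ext c z:]"
  by (rule poly_eqI) (auto simp: coeff_pCons split: nat.splits)

lemma poly_at_add: "\<forall>\<^sub>F z in near_line. poly_at z (p + q) = poly_at z p + poly_at z q"
proof -
  have "\<forall>\<^sub>F z in near_line. \<forall>k\<in>{..max (degree p) (degree q)}. ext (coeff p k + coeff q k) z = ext (coeff p k) z + ext (coeff q k) z"
    by (intro eventually_ball_finite ballI ext_add) auto
  then show ?thesis
  proof eventually_elim
    case (elim z)
    show ?case
    proof (rule poly_eqI)
      fix k show "coeff (poly_at z (p + q)) k = coeff (poly_at z p + poly_at z q) k"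
        using elim by (cases "k \<le> max (degree p) (degree q)") (auto simp: coeff_eq_0)
    qed
  qed
qed

lemma poly_at_mult: "\<forall>\<^sub>F z in near_line. poly_at z (p * q) = poly_at z p * poly_at z q"
proof -
  have "\<forall>\<^sub>F z in near_line. \<forall>k\<in>{..degree p + degree q}.
      ext (\<Sum>i\<le>k. coeff p i * coeff q (k - i)) z = (\<Sum>i\<le>k. ext (coeff p i) z * ext (coeff q (k - i)) z)"
    by (intro eventually_ball_finite ballI ext_sum_mult) auto
  then show ?thesis
  proof eventually_elim
    case (elim z)
    show ?case
    proof (rule poly_eqI)
      fix k show "coeff (poly_at z (p * q)) k = coeff (poly_at z p * poly_at z q) k"
      proof (cases "k \<le> degree p + degree q")
        case True
        then show ?thesis using elim by (simp add: coeff_mult)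
      next
        case False
        moreover have "degree (poly_at z p * poly_at z q) \<le> degree p + degree q"
          using degree_mult_le[of "poly_at z p" "poly_at z q"] degree_poly_at_le[of z p] degree_poly_at_le[of z q] by linarith
        ultimately have "degree (p * q) < k" "degree (poly_at z p * poly_at z q) < k"
          using degree_mult_le[of p q] by linarith+
        then show ?thesis by (simp add: coeff_eq_0)
      qed
    qed
  qed
qed

lemma poly_at_pderiv: "\<forall>\<^sub>F z in near_line. poly_at z (pderiv p) = pderiv (poly_at z p)"
proof -
  have "\<forall>\<^sub>F z in near_line. \<forall>k\<in>{..degree p}. ext (of_nat (Suc k) * coeff p (Suc k)) z = of_nat (Suc k) * ext (coeff p (Suc k)) z"
    by (intro eventually_ball_finite ballI ext_of_nat_mult) auto
  then show ?thesis
  proof eventually_elim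
    case (elim z)
    show ?case
    proof (rule poly_eqI)
      fix k show "coeff (poly_at z (pderiv p)) k = coeff (pderiv (poly_at z p)) k"
        using elim by (cases "k \<le> degree p") (auto simp: coeff_pderiv coeff_eq_0 simp del: of_nat_Suc)
    qed
  qed
qed

lemma common_strip:
  assumes "finite A"
  shows "\<exists>e>0. \<forall>f\<in>A. ext f holomorphic_on strip e"
  using assms
proof induction
  case (insert f A)
  then obtain e where e: "e > 0" "\<forall>f\<in>A. ext f holomorphic_on strip e" by blast
  obtain e' where e': "e' > 0" "ext f holomorphic_on strip e'"
    using holo_near_line_ext holo_near_line_def by blast
  have "ext g holomorphic_on strip (min e e')" if "g \<in> insert f A" for g
    using that e e' by (auto intro: holomorphic_on_subset)
  then show ?case using e(1) e'(1) by (intro exI[of _ "min e e'"]) auto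
qed (auto intro: exI[of _ 1])

lemma common_period:
  assumes "finite A"
  shows "\<exists>N>0. \<forall>f\<in>A. \<forall>(z::complex) k. ext f (z + of_nat (k * N) * (2 * pi)) = ext f z"
  using assms
proof induction
  case (insert f A)
  then obtain N where N: "N > 0" "\<And>g (z::complex) k. g \<in> A \<Longrightarrow> ext g (z + of_nat (k * N) * (2 * pi)) = ext g z"
    by blast
  obtain M where M: "M > 0" "\<And>(z::complex) k. ext f (z + of_nat (k * M) * (2 * pi)) = ext f z"
    by (rule ext_periodic[of f]) blast
  have "ext g (z + of_nat (k * (N * M)) * (2 * pi)) = ext g z" if "g \<in> insert f A" for g k and z :: complex
  proof (cases "g = f")
    case True
    then show ?thesis using M(2)[of z "k * N"] by (simp add: mult.assoc)
  next
    case False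
    then show ?thesis using N(2)[of g z "k * M"] that by (simp add: mult_ac)
  qed
  then show ?case using N(1) M(1) by (intro exI[of _ "N * M"]) auto
qed (auto intro: exI[of _ 1])

lemma finite_range_coeff: "finite (range (coeff p))"
proof -
  have "range (coeff p) \<subseteq> insert 0 (coeff p ` {..degree p})"
    using le_degree[of p] by fastforce
  then show ?thesis by (rule finite_subset) auto
qed

lemma poly_at_of_real: "poly_at (complex_of_real t) p = map_poly (\<lambda>f. val f t) p"
  by (simp add: poly_at_def)

lemma val_poly: "val (poly p f) t = poly (map_poly (\<lambda>g. val g t) p) (val f t)"
  by (induction p rule: pCons_induct) (auto simp: map_poly_pCons)

text \<open>Rellich's theorem. Only a root is constructed; by division the polynomial then splits into linear
factors. Without the reality assumption the statement fails: $x^3 = \sin t$ has no analytic solution.\<close>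

theorem real_rooted_has_root:
  fixes X :: "puis poly"
  assumes "0 < degree X" "lead_coeff X = 1"
    and real: "\<And>t x. poly (map_poly (\<lambda>f. val f t) X) x = 0 \<Longrightarrow> x \<in> \<real>"
  obtains l where "poly X l = 0" "conjugate l = l"
proof -
  obtain P E A B a D where P: "0 < degree P" "a \<noteq> 0" "D \<noteq> 0" "[:a:] * X = P * E"
    "A * P + B * pderiv P = [:D:]"
    by (rule separable_divisor[OF assms(1)])
  have lcP: "lead_coeff P \<noteq> 0" using P(1) by auto
  have "\<forall>\<^sub>F z in near_line. (Im z \<noteq> 0 \<longrightarrow> ext a z \<noteq> 0 \<and> ext (lead_coeff P) z \<noteq> 0 \<and> ext D z \<noteq> 0) \<and>
      ext 1 z = 1 \<and> [:ext a z:] * poly_at z X = poly_at z P * poly_at z E \<and>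
      poly_at z A * poly_at z P + poly_at z B * pderiv (poly_at z P) = [:ext D z:]"
    using ext_nonzero_off_line[OF P(2)] ext_nonzero_off_line[OF P(3)] ext_nonzero_off_line[OF lcP]
      ext_1 poly_at_mult[of "[:a:]" X] poly_at_mult[of P E] poly_at_mult[of A P] poly_at_mult[of B "pderiv P"]
      poly_at_pderiv[of P] poly_at_add[of "A * P" "B * pderiv P"]
    by eventually_elim (auto simp: P(4,5) poly_at_const simp del: mult_pCons_left)
  then obtain e1 where e1: "e1 > 0"
    "\<And>z. z \<in> upper_strip e1 \<Longrightarrow> ext a z \<noteq> 0 \<and> ext (lead_coeff P) z \<noteq> 0 \<and> ext D z \<noteq> 0"
    "\<And>z. z \<in> strip e1 \<Longrightarrow> ext 1 z = 1 \<and> [:ext a z:] * poly_at z X = poly_at z P * poly_at z E \<and>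
      poly_at z A * poly_at z P + poly_at z B * pderiv (poly_at z P) = [:ext D z:]"
    unfolding eventually_near_line by force
  \<comment> \<open>a strip on which all coefficients are holomorphic\<close>
  obtain e2 where e2: "e2 > 0" "\<And>f. f \<in> range (coeff P) \<union> range (coeff X) \<Longrightarrow> ext f holomorphic_on strip e2"
    using common_strip[of "range (coeff P) \<union> range (coeff X)"] finite_range_coeff by blast
  define e where "e = min e1 e2"
  have "e > 0" using e1 e2 by (simp add: e_def)
  have strip_holo: "ext (coeff P k) holomorphic_on strip e" "ext (coeff X k) holomorphic_on strip e" for k
    by (rule holomorphic_on_subset[OF e2(2)]; force simp: e_def)+
  define \<Omega> where "\<Omega> = upper_strip e"
  have \<Omega>: "z \<in> upper_strip e1" "z \<in> strip e1" "z \<in> strip e" if "z \<in> \<Omega>" for z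
    using that by (auto simp: \<Omega>_def e_def)
  have deg: "degree (poly_at z P) = degree P" if "z \<in> \<Omega>" for z
  proof (rule antisym[OF degree_poly_at_le])
    show "degree P \<le> degree (poly_at z P)" using e1(2)[OF \<Omega>(1)[OF that]] by (intro le_degree) simp
  qed
  \<comment> \<open>the Bezout identity excludes common roots of P and its derivative\<close>
  interpret separable_family "\<lambda>z. poly_at z P" \<Omega> "degree P"
  proof
    show "(\<lambda>z. coeff (poly_at z P) k) holomorphic_on \<Omega>" for k
      using strip_holo(1)[of k] by (auto simp: \<Omega>_def intro: holomorphic_on_subset)
    show "rsquarefree (poly_at z P)" if "z \<in> \<Omega>" for z
      unfolding rsquarefree_roots
    proof (intro allI notI)
      fix x assume "poly (poly_at z P) x = 0 \<and> poly (pderiv (poly_at z P)) x = 0"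
      then have "poly (poly_at z A * poly_at z P + poly_at z B * pderiv (poly_at z P)) x = 0" by simp
      then have "ext D z = 0" using e1(3)[OF \<Omega>(2)[OF that]] by simp
      then show False using e1(2)[OF \<Omega>(1)[OF that]] by simp
    qed
  qed (use P deg in \<open>auto simp: \<Omega>_def\<close>)
  obtain r where r: "r holomorphic_on \<Omega>" "\<And>z. z \<in> \<Omega> \<Longrightarrow> poly (poly_at z P) (r z) = 0"
    by (rule holomorphic_root_exists) blast
  have cont_r: "continuous_on \<Omega> r" using r(1) by (rule holomorphic_on_imp_continuous_on)
  \<comment> \<open>the branch of P is also one of the given polynomial, whose roots are real on the real line\<close>
  have rX: "poly (poly_at z X) (r z) = 0" if "z \<in> \<Omega>" for z
  proof -
    have "poly ([:ext a z:] * poly_at z X) (r z) = poly (poly_at z P * poly_at z E) (r z)"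
      using e1(3)[OF \<Omega>(2)[OF that]] by simp
    then show ?thesis using r(2)[OF that] e1(2)[OF \<Omega>(1)[OF that]] by simp
  qed
  have monic: "lead_coeff (poly_at z X) = 1 \<and> degree (poly_at z X) = degree X" if "z \<in> strip e" for z
  proof -
    have "ext 1 z = 1" using e1(3) that by (auto simp: e_def)
    then have "coeff (poly_at z X) (degree X) = 1" using assms(2) by simp
    moreover then have "degree (poly_at z X) = degree X"
      using degree_poly_at_le[of z X] le_degree[of "poly_at z X" "degree X"] by simp
    ultimately show ?thesis by simp
  qed
  have lim: "\<exists>x. poly (poly_at (complex_of_real t) X) x = 0 \<and> (r \<longlongrightarrow> x) (at (complex_of_real t) within \<Omega>)" for t
  proof (rule root_tendsto_at_boundary[where n = "degree X"])
    have t: "complex_of_real t \<in> strip e" using \<open>e > 0\<close> by simp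
    show "((\<lambda>z. coeff (poly_at z X) k) \<longlongrightarrow> coeff (poly_at (complex_of_real t) X) k) (at (complex_of_real t) within \<Omega>)" for k
    proof -
      have "isCont (ext (coeff X k)) (complex_of_real t)"
        using strip_holo(2)[of k] t holomorphic_on_imp_continuous_on continuous_on_eq_continuous_at open_strip by blast
      then show ?thesis unfolding isCont_def coeff_poly_at by (rule tendsto_within_subset) simp
    qed
    show "complex_of_real t islimpt \<Omega>" unfolding \<Omega>_def using \<open>e > 0\<close> by (rule real_islimpt_upper_strip)
    show "degree (poly_at z X) = degree X" "lead_coeff (poly_at z X) = 1" if "z \<in> insert (complex_of_real t) \<Omega>" for z
      using that monic[of z] \<Omega>(3)[of z] t by auto
  qed (use cont_r rX in \<open>auto simp: \<Omega>_def\<close>)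
  have real_lim: "\<exists>x\<in>\<real>. (r \<longlongrightarrow> x) (at (complex_of_real t) within upper_strip e)" for t
    using lim[of t] real[of t] unfolding \<Omega>_def poly_at_of_real by blast
  obtain R where R: "R holomorphic_on strip e" "\<And>z. z \<in> upper_strip e \<Longrightarrow> R z = r z"
    "\<And>t. R (complex_of_real t) \<in> \<real>"
    "\<And>t. (r \<longlongrightarrow> R (complex_of_real t)) (at (complex_of_real t) within upper_strip e)"
    by (rule holomorphic_extension_across_reals[OF \<open>e > 0\<close> r(1)[unfolded \<Omega>_def] real_lim]) blast
  have R_root: "poly (map_poly (\<lambda>f. val f t) X) (R (complex_of_real t)) = 0" for t
  proof -
    obtain x where x: "poly (poly_at (complex_of_real t) X) x = 0" "(r \<longlongrightarrow> x) (at (complex_of_real t) within \<Omega>)"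
      using lim by blast
    have "x = R (complex_of_real t)"
      using tendsto_unique[OF _ x(2) R(4)[of t, folded \<Omega>_def]] real_islimpt_upper_strip[OF \<open>e > 0\<close>, of t]
      by (simp add: \<Omega>_def trivial_limit_within)
    then show ?thesis using x(1) by (simp add: poly_at_of_real)
  qed
  obtain N where N: "N > 0" "\<And>f (z::complex) k. f \<in> range (coeff P) \<Longrightarrow> ext f (z + of_nat (k * N) * (2 * pi)) = ext f z"
    using common_period[OF finite_range_coeff[of P]] by blast
  \<comment> \<open>the translates of the branch by multiples of the common period are again root
    branches; by the pigeonhole principle two of them agree at a point, hence everywhere\<close>
  define T where "T k = of_nat (k * N) * (2 * complex_of_real pi)" for k
  have T_add: "T (j + k) = T j + T k" for j k by (simp add: T_def algebra_simps)
  have T_Im: "Im (T k) = 0" for k by (simp add: T_def)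
  have shift: "z + T k \<in> \<Omega> \<longleftrightarrow> z \<in> \<Omega>" "z - T k \<in> \<Omega> \<longleftrightarrow> z \<in> \<Omega>" for z k
    by (auto simp: \<Omega>_def T_Im)
  have poly_at_shift: "poly_at (z + T k) P = poly_at z P" for z k
    by (rule poly_eqI) (use N(2) in \<open>auto simp: T_def\<close>)
  have shifted: "continuous_on \<Omega> (\<lambda>z. r (z + T k))" "\<And>z. z \<in> \<Omega> \<Longrightarrow> poly (poly_at z P) (r (z + T k)) = 0" for k
  proof -
    show "continuous_on \<Omega> (\<lambda>z. r (z + T k))"
      by (rule continuous_on_compose2[OF cont_r]) (auto intro!: continuous_intros simp: shift)
    show "poly (poly_at z P) (r (z + T k)) = 0" if "z \<in> \<Omega>" for z
      using r(2)[of "z + T k"] that by (simp add: shift poly_at_shift)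
  qed
  define z1 where "z1 = Complex 0 (e / 2)"
  have z1: "z1 \<in> \<Omega>" using \<open>e > 0\<close> by (simp add: z1_def \<Omega>_def)
  have "(\<lambda>k. r (z1 + T k)) ` {..degree P} \<subseteq> {x. poly (poly_at z1 P) x = 0}"
    using shifted(2)[OF z1] by auto
  moreover have "finite {x. poly (poly_at z1 P) x = 0}" using nonzero[OF z1] poly_roots_finite by blast
  ultimately have "card ((\<lambda>k. r (z1 + T k)) ` {..degree P}) \<le> degree P"
    using card_mono card_roots[OF z1] by metis
  then have "\<not> inj_on (\<lambda>k. r (z1 + T k)) {..degree P}"
    by (intro pigeonhole) simp
  then obtain j k where jk: "j < k" "r (z1 + T j) = r (z1 + T k)"
    unfolding inj_on_def by (metis linorder_neqE_nat)
  have same: "r (z + T j) = r (z + T k)" if "z \<in> \<Omega>" for z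
    by (rule continuous_root_unique[OF shifted shifted z1 jk(2) that])
  have r_per: "r (z + T (k - j)) = r z" if "z \<in> \<Omega>" for z
  proof -
    have eq: "z - T j + T k = z + T (k - j)" using T_add[of j "k - j"] jk(1) by simp
    have "r (z - T j + T j) = r (z - T j + T k)" by (rule same) (use that in \<open>simp add: shift\<close>)
    then show ?thesis by (simp only: eq diff_add_cancel)
  qed
  have "R (z + T (k - j)) - R z = 0" if z: "z \<in> strip e" for z
  proof (rule analytic_continuation[of "\<lambda>z. R (z + T (k - j)) - R z" "strip e" \<Omega> z1 z])
    have "(R \<circ> (\<lambda>z. z + T (k - j))) holomorphic_on strip e"
      by (intro holomorphic_on_compose holomorphic_intros holomorphic_on_subset[OF R(1)]) (auto simp: T_Im)
    then show "(\<lambda>z. R (z + T (k - j)) - R z) holomorphic_on strip e"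
      by (intro holomorphic_intros R(1)) (simp add: o_def)
    show "z1 islimpt \<Omega>" using z1 open_dom by (simp add: interior_limit_point interior_open)
    show "R (z + T (k - j)) - R z = 0" if "z \<in> \<Omega>" for z
      using R(2)[of z] R(2)[of "z + T (k - j)"] r_per[OF that] that shift(1)[of z] by (simp add: \<Omega>_def T_Im)
  qed (use z z1 \<Omega>(3) in \<open>auto intro: convex_connected\<close>)
  then have "R (z + of_nat ((k - j) * N) * (2 * pi)) = R z" if "z \<in> strip e" for z
    using that by (simp add: T_def)
  then obtain l where l: "\<And>t. val l t = R (complex_of_real t)"
    using periodic_strip_function_is_val[OF R(1) \<open>e > 0\<close>, of "(k - j) * N"] jk(1) N(1) by auto
  have "poly X l = 0"
    by (rule puis_eqI) (simp add: val_poly l R_root)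
  moreover have "conjugate l = l"
    by (rule puis_eqI) (use R(3) l in \<open>auto simp: Reals_cnj_iff\<close>)
  ultimately show ?thesis by (rule that)
qed

section \<open>Unitary matrices over the ring\<close>

lemma val_hom: "comm_ring_hom (\<lambda>f. val f t)"
  by standard auto

definition adj :: "'a::conjugatable_ring mat \<Rightarrow> 'a mat" where
  "adj A = map_mat conjugate (transpose_mat A)"

lemma adj_carrier [simp]: "A \<in> carrier_mat m n \<Longrightarrow> adj A \<in> carrier_mat n m"
  by (auto simp: adj_def)

lemma adj_dim [simp]: "dim_row (adj A) = dim_col A" "dim_col (adj A) = dim_row A"
  by (auto simp: adj_def)

lemma adj_index [simp]: "i < dim_col A \<Longrightarrow> j < dim_row A \<Longrightarrow> adj A $$ (i, j) = conjugate (A $$ (j, i))"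
  by (auto simp: adj_def)

lemma adj_adj [simp]: "adj (adj A) = A"
  by (rule eq_matI) auto

lemma conjugate_sum_mult:
  "conjugate (\<Sum>i\<in>A. f i * g i :: 'a::{conjugatable_ring, comm_ring}) = (\<Sum>i\<in>A. conjugate (g i) * conjugate (f i))"
  by (induction A rule: infinite_finite_induct) (auto simp: conjugate_dist_add conjugate_dist_mul mult.commute)

lemma adj_mult:
  fixes A :: "'a::{conjugatable_ring, comm_ring} mat"
  assumes "A \<in> carrier_mat l m" "B \<in> carrier_mat m n"
  shows "adj (A * B) = adj B * adj A"
  by (rule eq_matI) (use assms in \<open>auto simp: scalar_prod_def conjugate_sum_mult\<close>)

lemma conjugate_1 [simp]: "conjugate (1 :: puis) = 1"
  by (rule puis_eqI) simp

lemma adj_one [simp]: "adj (1\<^sub>m n :: puis mat) = 1\<^sub>m n"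
  by (rule eq_matI) auto

lemma adj_four_block:
  assumes "A \<in> carrier_mat m1 n1" "B \<in> carrier_mat m1 n2" "C \<in> carrier_mat m2 n1" "D \<in> carrier_mat m2 n2"
  shows "adj (four_block_mat A B C D) = four_block_mat (adj A) (adj C) (adj B) (adj D)"
  by (rule eq_matI) (use assms in \<open>auto simp: adj_def\<close>)

lemma adj_zero [simp]: "adj (0\<^sub>m m n :: puis mat) = 0\<^sub>m n m"
  by (rule eq_matI) auto

definition unitary_mat :: "nat \<Rightarrow> puis mat \<Rightarrow> bool" where
  "unitary_mat n U \<longleftrightarrow> U \<in> carrier_mat n n \<and> U * adj U = 1\<^sub>m n \<and> adj U * U = 1\<^sub>m n"

lemma unitary_mult:
  assumes "unitary_mat n U" "unitary_mat n V"
  shows "unitary_mat n (U * V)"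
proof -
  have c: "U \<in> carrier_mat n n" "V \<in> carrier_mat n n" "adj U \<in> carrier_mat n n" "adj V \<in> carrier_mat n n"
    using assms by (auto simp: unitary_mat_def)
  have c2: "U * V \<in> carrier_mat n n" "adj V * adj U \<in> carrier_mat n n" "adj U * U \<in> carrier_mat n n"
    using c by (auto intro: mult_carrier_mat)
  have "U * V * (adj V * adj U) = U * (V * adj V) * adj U"
    using c c2 by (simp add: assoc_mult_mat[of _ n n _ n _ n])
  moreover have "adj V * adj U * (U * V) = adj V * (adj U * U) * V"
    using c c2 by (simp add: assoc_mult_mat[of _ n n _ n _ n])
  ultimately show ?thesis
    using assms c unfolding unitary_mat_def by (auto simp: adj_mult[OF c(1,2)])
qed

lemma unitary_four_block:
  assumes "unitary_mat n1 U" "unitary_mat n2 V"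
  shows "unitary_mat (n1 + n2) (four_block_mat U (0\<^sub>m n1 n2) (0\<^sub>m n2 n1) V)"
proof -
  have c: "U \<in> carrier_mat n1 n1" "V \<in> carrier_mat n2 n2" "adj U \<in> carrier_mat n1 n1" "adj V \<in> carrier_mat n2 n2"
    using assms by (auto simp: unitary_mat_def)
  show ?thesis
    unfolding unitary_mat_def adj_four_block[OF c(1) zero_carrier_mat zero_carrier_mat c(2)]
    using assms c
    by (auto simp: unitary_mat_def mult_four_block_mat[where ?nr1.0=n1 and ?n1.0=n1 and ?n2.0=n2 and ?nr2.0=n2 and ?nc1.0=n1 and ?nc2.0=n2])
qed

lemma unitary_one: "unitary_mat n (1\<^sub>m n)"
  by (simp add: unitary_mat_def)

lemma cnj_sum_square: "(\<Sum>i\<in>A. z i * cnj (z i)) = complex_of_real (\<Sum>i\<in>A. (cmod (z i))\<^sup>2)"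
  by (simp flip: complex_norm_square)

lemma gram_eigenvalue_real:
  assumes B: "B \<in> carrier_mat m n" and "eigenvalue (adj B * B) x"
  shows "(x :: complex) \<in> \<real>"
proof -
  obtain v where v: "v \<in> carrier_vec n" "v \<noteq> 0\<^sub>v n" "(adj B * B) *\<^sub>v v = x \<cdot>\<^sub>v v"
    using assms by (auto simp: eigenvalue_def eigenvector_def)
  define w where "w = B *\<^sub>v v"
  have w: "w \<in> carrier_vec m" using B v by (simp add: w_def)
  have eq: "x * v $ j = (\<Sum>i<m. cnj (B $$ (i, j)) * w $ i)" if "j < n" for j
  proof -
    have "x * v $ j = (adj B *\<^sub>v w) $ j"
      using v B that by (simp add: w_def assoc_mult_mat_vec[of _ n m _ n, symmetric])
    then show ?thesis using w B that by (simp add: scalar_prod_def lessThan_atLeast0)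
  qed
  have wi: "w $ i = (\<Sum>j<n. B $$ (i, j) * v $ j)" if "i < m" for i
    using that v B by (simp add: w_def scalar_prod_def lessThan_atLeast0)
  have "x * (\<Sum>j<n. v $ j * cnj (v $ j)) = (\<Sum>j<n. \<Sum>i<m. cnj (B $$ (i, j)) * w $ i * cnj (v $ j))"
    by (simp add: sum_distrib_left mult.assoc[symmetric] eq sum_distrib_right)
  also have "\<dots> = (\<Sum>i<m. \<Sum>j<n. cnj (B $$ (i, j)) * w $ i * cnj (v $ j))"
    by (rule sum.swap)
  also have "\<dots> = (\<Sum>i<m. w $ i * cnj (w $ i))"
    by (intro sum.cong refl) (simp add: wi sum_distrib_left mult_ac)
  finally have xeq: "x * complex_of_real (\<Sum>j<n. (cmod (v $ j))\<^sup>2) = complex_of_real (\<Sum>i<m. (cmod (w $ i))\<^sup>2)"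
    by (simp only: cnj_sum_square)
  obtain j where "j < n" "v $ j \<noteq> 0" using v(1,2) by (metis carrier_vecD eq_vecI index_zero_vec)
  then have "(\<Sum>j<n. (cmod (v $ j))\<^sup>2) > 0"
    by (intro sum_pos2[of _ j]) auto
  moreover have "x \<in> \<real>" if "x * complex_of_real a = complex_of_real b" "a > 0" for a b
  proof -
    have "x = complex_of_real (b / a)" using that by (simp add: field_simps)
    then show ?thesis by simp
  qed
  ultimately show ?thesis using xeq by blast
qed

lemma mult_mat_vec_smult:
  fixes A :: "'a::comm_ring mat"
  assumes "A \<in> carrier_mat m n" "v \<in> carrier_vec n"
  shows "A *\<^sub>v (k \<cdot>\<^sub>v v) = k \<cdot>\<^sub>v (A *\<^sub>v v)"
  by (rule eq_vecI) (use assms in \<open>auto simp: scalar_prod_def sum_distrib_left mult_ac\<close>)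

lemma scalar_mat_mult_vec:
  fixes v :: "'a::comm_ring_1 vec"
  assumes "v \<in> carrier_vec n"
  shows "(k \<cdot>\<^sub>m 1\<^sub>m n) *\<^sub>v v = k \<cdot>\<^sub>v v"
proof (rule eq_vecI)
  fix i assume "i < dim_vec (k \<cdot>\<^sub>v v)"
  then have i: "i < n" using assms by simp
  have "((k \<cdot>\<^sub>m 1\<^sub>m n) *\<^sub>v v) $ i = (\<Sum>j\<in>{0..<n}. k * (if j = i then 1 else 0) * v $ j)"
    using assms i by (simp add: scalar_prod_def)
  also have "\<dots> = (\<Sum>j\<in>{0..<n}. if j = i then k * v $ j else 0)"
    by (intro sum.cong refl) auto
  also have "\<dots> = (k \<cdot>\<^sub>v v) $ i" using assms i by simp
  finally show "((k \<cdot>\<^sub>m 1\<^sub>m n) *\<^sub>v v) $ i = (k \<cdot>\<^sub>v v) $ i" .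
qed (use assms in auto)

text \<open>A root of the characteristic polynomial in the ring makes a determinant over an integral domain
vanish, which yields a kernel vector after clearing denominators. Rellich's theorem applies since the
eigenvalues of a matrix $B^* B$ are real.\<close>

lemma gram_eigenvector_exists:
  fixes A :: "puis mat"
  assumes A: "A \<in> carrier_mat m n" and "0 < n"
  obtains l v where "conjugate l = l" "v \<in> carrier_vec n" "v \<noteq> 0\<^sub>v n" "adj A *\<^sub>v (A *\<^sub>v v) = l \<cdot>\<^sub>v v"
proof -
  define M where "M = adj A * A"
  have M: "M \<in> carrier_mat n n" unfolding M_def using A by (intro mult_carrier_mat[of _ n m]) auto
  have monic: "degree (char_poly M) = n" "lead_coeff (char_poly M) = 1"
    using degree_monic_char_poly[OF M] by auto
  have real: "x \<in> \<real>" if "poly (map_poly (\<lambda>f. val f t) (char_poly M)) x = 0" for t x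
  proof -
    interpret ev: comm_ring_hom "\<lambda>f. val f t" by (rule val_hom)
    define B where "B = map_mat (\<lambda>f. val f t) A"
    have B: "B \<in> carrier_mat m n" using A by (simp add: B_def)
    have "map_mat (\<lambda>f. val f t) M = map_mat (\<lambda>f. val f t) (adj A) * B"
      unfolding M_def B_def using A by (intro ev.mat_hom_mult) auto
    also have "map_mat (\<lambda>f. val f t) (adj A) = adj B"
      by (rule eq_matI) (use A in \<open>auto simp: B_def\<close>)
    finally have "char_poly (adj B * B) = map_poly (\<lambda>f. val f t) (char_poly M)"
      using ev.char_poly_hom[OF M] by simp
    then have "eigenvalue (adj B * B) x"
      using that B by (subst eigenvalue_root_char_poly[of _ n]) auto
    then show ?thesis by (rule gram_eigenvalue_real[OF B])
  qed
  obtain l where l: "poly (char_poly M) l = 0" "conjugate l = l"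
    by (rule real_rooted_has_root[of "char_poly M"]) (use monic \<open>0 < n\<close> real in auto)
  have ph: "comm_ring_hom (\<lambda>p. poly p l)" by standard auto
  define C where "C = map_mat (\<lambda>p. poly p l) (char_poly_matrix M)"
  have C: "C \<in> carrier_mat n n" using M by (simp add: C_def)
  have "det C = 0" using l(1) by (simp add: C_def comm_ring_hom.hom_det[OF ph] char_poly_def)
  then obtain v where v: "v \<in> carrier_vec n" "v \<noteq> 0\<^sub>v n" "C *\<^sub>v v = 0\<^sub>v n"
    using det_0_iff_vec_prod_zero[OF C] by blast
  have "C = l \<cdot>\<^sub>m 1\<^sub>m n - M"
    by (rule eq_matI) (use M in \<open>auto simp: C_def char_poly_matrix_def\<close>)
  then have "C *\<^sub>v v = l \<cdot>\<^sub>v v - M *\<^sub>v v"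
    using v(1) M by (simp add: minus_mult_distrib_mat_vec[of _ n n] scalar_mat_mult_vec)
  then have eq0: "l \<cdot>\<^sub>v v - M *\<^sub>v v = 0\<^sub>v n" using v by simp
  have "M *\<^sub>v v = l \<cdot>\<^sub>v v"
  proof (rule eq_vecI)
    fix i assume "i < dim_vec (l \<cdot>\<^sub>v v)"
    then have i: "i < n" using v by simp
    then have "(l \<cdot>\<^sub>v v - M *\<^sub>v v) $ i = 0" by (simp add: eq0)
    then show "(M *\<^sub>v v) $ i = (l \<cdot>\<^sub>v v) $ i" using i v(1) M by simp
  qed (use v M in auto)
  then have "adj A *\<^sub>v (A *\<^sub>v v) = l \<cdot>\<^sub>v v"
    using A v by (simp add: M_def assoc_mult_mat_vec[of _ n m _ n])
  then show ?thesis using l(2) v(1,2) by (intro that)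
qed

text \<open>The polynomial $x^2 - h$ has real roots everywhere. The square root may change sign at zeros of \<open>h\<close>;
the nonnegative root is in general not analytic.\<close>

lemma nonneg_has_real_sqrt:
  assumes "\<And>t. val h t = complex_of_real (q t)" "\<And>t. 0 \<le> q t"
  obtains c where "conjugate c = c" "c * c = (h :: puis)"
proof -
  have real: "x \<in> \<real>" if "poly (map_poly (\<lambda>f. val f t) [:- h, 0, 1:]) x = 0" for t x
  proof -
    have "x\<^sup>2 = (complex_of_real (sqrt (q t)))\<^sup>2"
      using that assms(2)[of t] by (simp add: map_poly_pCons assms(1) power2_eq_square flip: of_real_mult)
    then show ?thesis by (auto simp: power2_eq_iff)
  qed
  obtain c where "poly [:- h, 0, 1:] c = 0" "conjugate c = c"
    by (rule real_rooted_has_root[of "[:- h, 0, 1:]"]) (use real in auto)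
  then show ?thesis by (intro that[of c]) auto
qed

definition unit_norm :: "nat \<Rightarrow> puis vec \<Rightarrow> bool" where
  "unit_norm n v \<longleftrightarrow> v \<in> carrier_vec n \<and> (\<Sum>i<n. v $ i * conjugate (v $ i)) = 1"

text \<open>The squared norm of \<open>v\<close> is a square $c^2$ with real \<open>c\<close>. The entries of \<open>v\<close> are bounded by $|c|$,
so they are divisible by \<open>c\<close>, even at common zeros of the entries.\<close>

lemma normalize_vec:
  fixes v :: "puis vec"
  assumes v: "v \<in> carrier_vec n" "v \<noteq> 0\<^sub>v n"
  obtains c u where "conjugate c = c" "c \<noteq> 0" "unit_norm n u" "v = c \<cdot>\<^sub>v u"
proof -
  define h where "h = (\<Sum>i<n. v $ i * conjugate (v $ i))"
  have h: "val h t = complex_of_real (\<Sum>i<n. (cmod (val (v $ i) t))\<^sup>2)" for t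
    by (simp add: h_def val_sum cnj_sum_square del: of_real_sum)
  obtain c where c: "conjugate c = c" "c * c = h"
    by (rule nonneg_has_real_sqrt[OF h]) (auto intro: sum_nonneg)
  have "cmod (val (v $ i) t) \<le> cmod (val c t)" if "i < n" for i t
  proof -
    have "(cmod (val c t))\<^sup>2 = cmod (val h t)" by (simp flip: c(2) add: norm_mult power2_eq_square)
    also have "\<dots> = (\<Sum>i<n. (cmod (val (v $ i) t))\<^sup>2)"
      unfolding h norm_of_real by (simp add: sum_nonneg)
    finally have "(cmod (val (v $ i) t))\<^sup>2 \<le> (cmod (val c t))\<^sup>2"
      using that by (auto intro: member_le_sum)
    then show ?thesis by (rule power2_le_imp_le) simp
  qed
  then have "\<forall>i<n. \<exists>w. v $ i = c * w" using divides_if_norm_le by blast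
  then obtain w where w: "\<And>i. i < n \<Longrightarrow> v $ i = c * w i" by metis
  have "c \<noteq> 0"
  proof
    assume "c = 0"
    then have "v = 0\<^sub>v n" using w v(1) by (intro eq_vecI) auto
    then show False using v(2) by simp
  qed
  define u where "u = vec n w"
  have "c * c * (\<Sum>i<n. u $ i * conjugate (u $ i)) = h"
    by (simp add: h_def u_def sum_distrib_left w conjugate_dist_mul c(1) mult_ac)
  then have "c * c * (\<Sum>i<n. u $ i * conjugate (u $ i)) = c * c * 1" using c(2) by simp
  then have "(\<Sum>i<n. u $ i * conjugate (u $ i)) = 1"
    using \<open>c \<noteq> 0\<close> by (metis mult_cancel_left mult_eq_0_iff)
  then have "unit_norm n u" by (simp add: unit_norm_def u_def)
  moreover have "v = c \<cdot>\<^sub>v u" by (rule eq_vecI) (use v w in \<open>auto simp: u_def\<close>)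
  ultimately show ?thesis using c(1) \<open>c \<noteq> 0\<close> by (intro that)
qed

text \<open>With $w = e_k - v$ and $\beta = w^* e_k$, the matrix $U = I - w w^* / \beta$ maps $e_k$ to $e_k - w = v$.
It is unitary because $w^* w = \beta + \bar\beta$ for $v$ of norm $1$. The division is possible in the ring
since the entries of $w w^*$ are bounded by $w^* w \le 2 |\beta|$.\<close>

lemma unitary_with_column:
  assumes v: "unit_norm n v" and k: "k < n"
  obtains U where "unitary_mat n U" "col U k = v"
proof -
  define w where "w i = (if i = k then 1 else 0) - v $ i" for i
  define b where "b = conjugate (w k)"
  have b: "b = 1 - conjugate (v $ k)" "conjugate b = 1 - v $ k"
    by (rule puis_eqI; simp add: b_def w_def)+
  have vn: "v \<in> carrier_vec n" and v1: "(\<Sum>i<n. v $ i * conjugate (v $ i)) = 1"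
    using v by (auto simp: unit_norm_def)
  have wsum: "(\<Sum>i<n. w i * conjugate (w i)) = b + conjugate b"
  proof -
    have "w i * conjugate (w i) = (if i = k then 1 - v $ k - conjugate (v $ k) else 0) + v $ i * conjugate (v $ i)" for i
      by (rule puis_eqI) (simp add: w_def algebra_simps)
    then have "(\<Sum>i<n. w i * conjugate (w i)) = 1 - v $ k - conjugate (v $ k) + 1"
      using k v1 by (simp add: sum.distrib)
    then show ?thesis unfolding b(2) unfolding b(1) by simp
  qed
  have wnorm: "(\<Sum>i<n. (cmod (val (w i) t))\<^sup>2) \<le> cmod (val (b + b) t)" for t
  proof -
    have "complex_of_real (\<Sum>i<n. (cmod (val (w i) t))\<^sup>2) = val (b + conjugate b) t"
      by (subst wsum[symmetric]) (simp add: val_sum cnj_sum_square del: of_real_sum)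
    then have "(\<Sum>i<n. (cmod (val (w i) t))\<^sup>2) = 2 * Re (val b t)"
      by (metis Re_complex_of_real complex_add_cnj of_real_eq_iff val_add val_conjugate)
    also have "\<dots> \<le> 2 * cmod (val b t)" using complex_Re_le_cmod by simp
    also have "\<dots> = cmod (val (b + b) t)"
      unfolding val_add by (simp flip: mult_2 add: norm_mult)
    finally show ?thesis .
  qed
  have wle: "(cmod (val (w i) t))\<^sup>2 \<le> cmod (val (b + b) t)" if "i < n" for i t
    using wnorm[of t] member_le_sum[of i "{..<n}" "\<lambda>i. (cmod (val (w i) t))\<^sup>2"] that by force
  show ?thesis
  proof (cases "b = 0")
    case True
    have "w i = 0" if "i < n" for i
      by (rule puis_eqI) (use wle[OF that] True in auto)
    then have "v $ i = (if i = k then 1 else 0)" if "i < n" for i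
      using that by (simp add: w_def)
    then have "col (1\<^sub>m n) k = v"
      using vn k by (intro eq_vecI) auto
    then show ?thesis by (rule that[OF unitary_one])
  next
    case False
    have "cmod (val (w i * conjugate (w j)) t) \<le> cmod (val (b + b) t)" if ij: "i < n" "j < n" for i j t
    proof -
      have "(cmod (val (w i) t) * cmod (val (w j) t))\<^sup>2 \<le> (cmod (val (b + b) t))\<^sup>2"
        unfolding power_mult_distrib power2_eq_square[of "cmod (val (b + b) t)"]
        by (rule mult_mono[OF wle[OF ij(1)] wle[OF ij(2)]]) simp_all
      then have "cmod (val (w i) t) * cmod (val (w j) t) \<le> cmod (val (b + b) t)"
        by (rule power2_le_imp_le) simp
      then show ?thesis by (simp add: norm_mult del: val_add)
    qed
    then have "\<forall>i<n. \<forall>j<n. \<exists>q. w i * conjugate (w j) = (b + b) * q"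
      using divides_if_norm_le by blast
    then obtain q' where q': "\<And>i j. i < n \<Longrightarrow> j < n \<Longrightarrow> w i * conjugate (w j) = (b + b) * q' i j"
      by metis
    \<comment> \<open>the bound gives quotients by b + b; twice these are the quotients by b\<close>
    define q where "q i j = q' i j + q' i j" for i j
    have q: "b * q i j = w i * conjugate (w j)" if "i < n" "j < n" for i j
      using q'[OF that] by (simp add: q_def algebra_simps)
    have qc: "conjugate b * conjugate (q i j) = conjugate (w i) * w j" if "i < n" "j < n" for i j
      using arg_cong[OF q[OF that], of conjugate] by (simp add: conjugate_dist_mul)
    have bb: "b * conjugate b \<noteq> 0" using False by simp
    have rows: "(\<Sum>l<n. q i l * conjugate (q j l)) = q i j + conjugate (q j i)" if ij: "i < n" "j < n" for i j
    proof -
      have "b * conjugate b * (\<Sum>l<n. q i l * conjugate (q j l)) = (\<Sum>l<n. (b * q i l) * (conjugate b * conjugate (q j l)))"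
        by (simp add: sum_distrib_left mult_ac)
      also have "\<dots> = (\<Sum>l<n. (w i * conjugate (w j)) * (w l * conjugate (w l)))"
        using ij by (intro sum.cong refl) (simp add: q qc mult_ac)
      also have "\<dots> = (w i * conjugate (w j)) * (b + conjugate b)"
        by (simp add: wsum flip: sum_distrib_left)
      also have "\<dots> = conjugate b * (b * q i j) + b * (conjugate b * conjugate (q j i))"
        using ij by (simp add: q qc algebra_simps)
      also have "\<dots> = b * conjugate b * (q i j + conjugate (q j i))"
        by (simp add: algebra_simps)
      finally show ?thesis by (rule mult_left_cancel[OF bb, THEN iffD1])
    qed
    have cols: "(\<Sum>l<n. conjugate (q l i) * q l j) = q i j + conjugate (q j i)" if ij: "i < n" "j < n" for i j
    proof -
      have "b * conjugate b * (\<Sum>l<n. conjugate (q l i) * q l j) = (\<Sum>l<n. (b * q l j) * (conjugate b * conjugate (q l i)))"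
        by (simp add: sum_distrib_left mult_ac)
      also have "\<dots> = (\<Sum>l<n. (w i * conjugate (w j)) * (w l * conjugate (w l)))"
        using ij by (intro sum.cong refl) (simp add: q qc mult_ac)
      also have "\<dots> = (w i * conjugate (w j)) * (b + conjugate b)"
        by (simp add: wsum flip: sum_distrib_left)
      also have "\<dots> = conjugate b * (b * q i j) + b * (conjugate b * conjugate (q j i))"
        using ij by (simp add: q qc algebra_simps)
      also have "\<dots> = b * conjugate b * (q i j + conjugate (q j i))"
        by (simp add: algebra_simps)
      finally show ?thesis by (rule mult_left_cancel[OF bb, THEN iffD1])
    qed
    define dl :: "nat \<Rightarrow> nat \<Rightarrow> puis" where "dl i j = (if i = j then 1 else 0)" for i j
    have dlc: "conjugate (dl i j) = dl i j" for i j by (simp add: dl_def)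
    have dlsum: "(\<Sum>l<n. dl i l * f l) = f i" "(\<Sum>l<n. dl l i * f l) = f i" if "i < n" for i f
      using that by (simp_all add: dl_def if_distrib[of "\<lambda>x. x * _"] cong: if_cong)
    define U where "U = mat n n (\<lambda>(i, j). dl i j - q i j)"
    have diffc: "conjugate (x - y) = conjugate x - conjugate (y :: puis)" for x y
      by (rule puis_eqI) simp
    have "U * adj U = 1\<^sub>m n"
    proof (rule eq_matI)
      fix i j assume "i < dim_row (1\<^sub>m n :: puis mat)" "j < dim_col (1\<^sub>m n :: puis mat)"
      then have ij: "i < n" "j < n" by auto
      have "(U * adj U) $$ (i, j) = (\<Sum>l<n. (dl i l - q i l) * (dl j l - conjugate (q j l)))"
        using ij by (simp add: U_def scalar_prod_def lessThan_atLeast0 diffc dlc)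
      also have "\<dots> = (\<Sum>l<n. dl i l * dl j l - dl i l * conjugate (q j l) - dl j l * q i l + q i l * conjugate (q j l))"
        by (intro sum.cong refl) (simp add: algebra_simps)
      also have "\<dots> = dl j i - conjugate (q j i) - q i j + (\<Sum>l<n. q i l * conjugate (q j l))"
        using ij by (simp add: sum.distrib sum_subtractf dlsum)
      also have "\<dots> = 1\<^sub>m n $$ (i, j)"
        using ij by (simp add: rows dl_def)
      finally show "(U * adj U) $$ (i, j) = 1\<^sub>m n $$ (i, j)" .
    qed (simp_all add: U_def)
    moreover have "adj U * U = 1\<^sub>m n"
    proof (rule eq_matI)
      fix i j assume "i < dim_row (1\<^sub>m n :: puis mat)" "j < dim_col (1\<^sub>m n :: puis mat)"
      then have ij: "i < n" "j < n" by auto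
      have "(adj U * U) $$ (i, j) = (\<Sum>l<n. (dl l i - conjugate (q l i)) * (dl l j - q l j))"
        using ij by (simp add: U_def scalar_prod_def lessThan_atLeast0 diffc dlc)
      also have "\<dots> = (\<Sum>l<n. dl l i * dl l j - dl l i * q l j - dl l j * conjugate (q l i) + conjugate (q l i) * q l j)"
        by (intro sum.cong refl) (simp add: algebra_simps)
      also have "\<dots> = dl i j - q i j - conjugate (q j i) + (\<Sum>l<n. conjugate (q l i) * q l j)"
        using ij by (simp add: sum.distrib sum_subtractf dlsum)
      also have "\<dots> = 1\<^sub>m n $$ (i, j)"
        using ij by (simp add: cols dl_def)
      finally show "(adj U * U) $$ (i, j) = 1\<^sub>m n $$ (i, j)" .
    qed (simp_all add: U_def)
    ultimately have "unitary_mat n U" by (simp add: unitary_mat_def U_def)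
    moreover have "col U k = v"
    proof (rule eq_vecI)
      fix i assume "i < dim_vec v"
      then have i: "i < n" using vn by simp
      have "b * q i k = b * w i" using q[OF i k] by (simp add: b_def mult.commute)
      then have "q i k = w i" using False by simp
      then show "col U k $ i = v $ i" using i k by (simp add: U_def w_def dl_def)
    qed (use vn k in \<open>simp add: U_def\<close>)
    ultimately show ?thesis by (rule that)
  qed
qed

section \<open>Singular value decomposition over the ring\<close>

definition has_svd :: "nat \<Rightarrow> nat \<Rightarrow> puis mat \<Rightarrow> bool" where
  "has_svd m n A \<longleftrightarrow> (\<exists>U S V. unitary_mat m U \<and> unitary_mat n V \<and> S \<in> carrier_mat m n \<and>
     (\<forall>i<m. \<forall>j<n. (i \<noteq> j \<longrightarrow> S $$ (i, j) = 0) \<and> conjugate (S $$ (i, j)) = S $$ (i, j)) \<and>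
     A = U * S * adj V)"

lemma has_svd_unitary:
  assumes U1: "unitary_mat m U1" and V1: "unitary_mat n V1" and B: "has_svd m n B"
  shows "has_svd m n (U1 * B * adj V1)"
proof -
  from B obtain U S V where *: "unitary_mat m U" "unitary_mat n V" "S \<in> carrier_mat m n"
    "\<forall>i<m. \<forall>j<n. (i \<noteq> j \<longrightarrow> S $$ (i, j) = 0) \<and> conjugate (S $$ (i, j)) = S $$ (i, j)" "B = U * S * adj V"
    unfolding has_svd_def by blast
  have c: "U \<in> carrier_mat m m" "U1 \<in> carrier_mat m m" "V \<in> carrier_mat n n" "V1 \<in> carrier_mat n n"
    "adj V \<in> carrier_mat n n" "adj V1 \<in> carrier_mat n n"
    using * U1 V1 by (auto simp: unitary_mat_def)
  have "U1 * (U * S * adj V) * adj V1 = (U1 * U) * S * (adj V * adj V1)"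
  proof -
    have "U1 * U * S = U1 * (U * S)"
      using c *(3) by (intro assoc_mult_mat[of _ m m _ m _ n]) auto
    moreover have "U1 * (U * S) * adj V = U1 * (U * S * adj V)"
      using c *(3) by (intro assoc_mult_mat[of _ m m _ n _ n]) auto
    moreover have "U1 * U * S * adj V * adj V1 = U1 * U * S * (adj V * adj V1)"
      using c *(3) by (intro assoc_mult_mat[of _ m n _ n _ n]) (auto intro!: mult_carrier_mat)
    ultimately show ?thesis by simp
  qed
  then have "U1 * B * adj V1 = (U1 * U) * S * adj (V1 * V)"
    by (simp add: *(5) adj_mult[OF c(4,3)])
  then show ?thesis
    unfolding has_svd_def using *(3,4) unitary_mult[OF U1 *(1)] unitary_mult[OF V1 *(2)] by blast
qed

lemma has_svd_bordered:
  assumes "has_svd m n A" "conjugate r = r"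
  shows "has_svd (1 + m) (1 + n) (four_block_mat (mat 1 1 (\<lambda>_. r)) (0\<^sub>m 1 n) (0\<^sub>m m 1) A)"
proof -
  from assms(1) obtain U S V where *: "unitary_mat m U" "unitary_mat n V" "S \<in> carrier_mat m n"
    "\<forall>i<m. \<forall>j<n. (i \<noteq> j \<longrightarrow> S $$ (i, j) = 0) \<and> conjugate (S $$ (i, j)) = S $$ (i, j)" "A = U * S * adj V"
    unfolding has_svd_def by blast
  have c: "U \<in> carrier_mat m m" "V \<in> carrier_mat n n" "adj V \<in> carrier_mat n n"
    using * by (auto simp: unitary_mat_def)
  let ?R = "mat 1 1 (\<lambda>_. r)"
  let ?U = "four_block_mat (1\<^sub>m 1) (0\<^sub>m 1 m) (0\<^sub>m m 1) U"
  let ?S = "four_block_mat ?R (0\<^sub>m 1 n) (0\<^sub>m m 1) S"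
  let ?V = "four_block_mat (1\<^sub>m 1) (0\<^sub>m 1 n) (0\<^sub>m n 1) V"
  have US: "U * S \<in> carrier_mat m n" using c *(3) by auto
  have "?U * ?S = four_block_mat ?R (0\<^sub>m 1 n) (0\<^sub>m m 1) (U * S)"
    by (subst mult_four_block_mat[of _ 1 1 _ m _ m _ _ 1 _ n]) (use c *(3) US in auto)
  moreover have "adj ?V = four_block_mat (1\<^sub>m 1) (0\<^sub>m 1 n) (0\<^sub>m n 1) (adj V)"
    by (subst adj_four_block[of _ 1 1 _ n _ n]) (use c in auto)
  moreover have "four_block_mat ?R (0\<^sub>m 1 n) (0\<^sub>m m 1) (U * S) * four_block_mat (1\<^sub>m 1) (0\<^sub>m 1 n) (0\<^sub>m n 1) (adj V) =
      four_block_mat ?R (0\<^sub>m 1 n) (0\<^sub>m m 1) A"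
    by (subst mult_four_block_mat[of _ 1 1 _ n _ m _ _ 1 _ n]) (use c *(3,5) US in auto)
  ultimately have "four_block_mat ?R (0\<^sub>m 1 n) (0\<^sub>m m 1) A = ?U * ?S * adj ?V" by simp
  moreover have "unitary_mat (1 + m) ?U" "unitary_mat (1 + n) ?V"
    using unitary_four_block[OF unitary_one[of 1]] *(1,2) by auto
  moreover have "?S \<in> carrier_mat (1 + m) (1 + n)" using *(3) by auto
  moreover have "\<forall>i<1 + m. \<forall>j<1 + n. (i \<noteq> j \<longrightarrow> ?S $$ (i, j) = 0) \<and> conjugate (?S $$ (i, j)) = ?S $$ (i, j)"
    using *(3) assms(2) by (auto simp: less_Suc_eq_0_disj) (use *(4) in blast)+
  ultimately show ?thesis unfolding has_svd_def by blast
qed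

lemma has_svd_zero_column:
  assumes "has_svd m n A"
  shows "has_svd m (n + 1) (four_block_mat A (0\<^sub>m m 1) (0\<^sub>m 0 n) (0\<^sub>m 0 1))"
proof -
  from assms(1) obtain U S V where *: "unitary_mat m U" "unitary_mat n V" "S \<in> carrier_mat m n"
    "\<forall>i<m. \<forall>j<n. (i \<noteq> j \<longrightarrow> S $$ (i, j) = 0) \<and> conjugate (S $$ (i, j)) = S $$ (i, j)" "A = U * S * adj V"
    unfolding has_svd_def by blast
  have c: "U \<in> carrier_mat m m" "V \<in> carrier_mat n n" "adj V \<in> carrier_mat n n"
    using * by (auto simp: unitary_mat_def)
  let ?S = "four_block_mat S (0\<^sub>m m 1) (0\<^sub>m 0 n) (0\<^sub>m 0 1)"
  let ?V = "four_block_mat V (0\<^sub>m n 1) (0\<^sub>m 1 n) (1\<^sub>m 1)"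
  have US: "U * S \<in> carrier_mat m n" using c *(3) by auto
  have "U * ?S = four_block_mat (U * S) (0\<^sub>m m 1) (0\<^sub>m 0 n) (0\<^sub>m 0 1)"
    by (rule eq_matI) (use c *(3) in \<open>auto simp: scalar_prod_def less_Suc_eq\<close>)
  moreover have "adj ?V = four_block_mat (adj V) (0\<^sub>m n 1) (0\<^sub>m 1 n) (1\<^sub>m 1)"
    by (subst adj_four_block[of _ n n _ 1 _ 1]) (use c in auto)
  moreover have "four_block_mat (U * S) (0\<^sub>m m 1) (0\<^sub>m 0 n) (0\<^sub>m 0 1) * four_block_mat (adj V) (0\<^sub>m n 1) (0\<^sub>m 1 n) (1\<^sub>m 1) =
      four_block_mat A (0\<^sub>m m 1) (0\<^sub>m 0 n) (0\<^sub>m 0 1)"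
    by (subst mult_four_block_mat[of _ m n _ 1 _ 0 _ _ n _ 1]) (use c *(3,5) US in auto)
  ultimately have "four_block_mat A (0\<^sub>m m 1) (0\<^sub>m 0 n) (0\<^sub>m 0 1) = U * ?S * adj ?V" by simp
  moreover have "unitary_mat (n + 1) ?V"
    using unitary_four_block[OF *(2) unitary_one[of 1]] by auto
  moreover have "?S \<in> carrier_mat m (n + 1)" using *(3) by auto
  moreover have "\<forall>i<m. \<forall>j<n + 1. (i \<noteq> j \<longrightarrow> ?S $$ (i, j) = 0) \<and> conjugate (?S $$ (i, j)) = ?S $$ (i, j)"
    using *(3) by (auto simp: less_Suc_eq) (use *(4) in blast)+
  ultimately show ?thesis unfolding has_svd_def using *(1) by blast
qed

lemma unitary_decompose:
  assumes "unitary_mat m U" "unitary_mat n V" "A \<in> carrier_mat m n"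
  shows "A = U * (adj U * A * V) * adj V"
proof -
  have c: "U \<in> carrier_mat m m" "V \<in> carrier_mat n n" "adj U \<in> carrier_mat m m" "adj V \<in> carrier_mat n n"
    and u: "U * adj U = 1\<^sub>m m" "V * adj V = 1\<^sub>m n"
    using assms by (auto simp: unitary_mat_def)
  have AV: "adj U * A \<in> carrier_mat m n" "adj U * A * V \<in> carrier_mat m n" using c assms(3) by auto
  have "U * (adj U * A * V) * adj V = U * ((adj U * A) * (V * adj V))"
    using c AV by (simp add: assoc_mult_mat[of _ m m _ n _ n] assoc_mult_mat[of _ m n _ n _ n])
  also have "\<dots> = (U * adj U) * A"
    using c AV assms(3) u(2) by (simp add: assoc_mult_mat[of _ m m _ m _ n])
  finally show ?thesis using u(1) assms(3) by simp
qed

lemma unitary_adj_col: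
  assumes U: "unitary_mat n U" and k: "k < n" and i: "i < n"
  shows "(adj U *\<^sub>v col U k) $ i = (if i = k then 1 else 0)"
proof -
  have c: "U \<in> carrier_mat n n" using U by (simp add: unitary_mat_def)
  have "(adj U *\<^sub>v col U k) $ i = (adj U * U) $$ (i, k)" using c k i by simp
  also have "\<dots> = (if i = k then 1 else 0)" using U k i by (simp add: unitary_mat_def)
  finally show ?thesis .
qed

text \<open>From $l = v^* A^* A v = r^2$ and $r A^* u = A^* A v = l v$ one obtains $r A^* u = r^2 v$, and \<open>r\<close> can
be cancelled.\<close>

lemma left_singular_vector:
  assumes A: "A \<in> carrier_mat m n" and v: "unit_norm n v" and u: "unit_norm m u"
    and r: "conjugate r = r" "r \<noteq> 0" and Av: "A *\<^sub>v v = r \<cdot>\<^sub>v u"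
    and eig: "adj A *\<^sub>v (A *\<^sub>v v) = l \<cdot>\<^sub>v v"
  shows "adj A *\<^sub>v u = r \<cdot>\<^sub>v v"
proof -
  have vn: "v \<in> carrier_vec n" and um: "u \<in> carrier_vec m"
    using u v by (simp_all add: unit_norm_def)
  have Avi: "(\<Sum>j<n. A $$ (i, j) * v $ j) = r * u $ i" if "i < m" for i
    using arg_cong[OF Av, of "\<lambda>x. vec_index x i"] that A vn um by (simp add: scalar_prod_def lessThan_atLeast0)
  have lv: "l * v $ j = (\<Sum>i<m. conjugate (A $$ (i, j)) * (r * u $ i))" if "j < n" for j
    using arg_cong[OF eig, of "\<lambda>x. vec_index x j"] that A vn um unfolding Av by (simp add: scalar_prod_def lessThan_atLeast0)
  have "l = l * (\<Sum>j<n. v $ j * conjugate (v $ j))"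
    using v by (simp add: unit_norm_def)
  also have "\<dots> = (\<Sum>j<n. (l * v $ j) * conjugate (v $ j))"
    by (simp add: sum_distrib_left mult.assoc)
  also have "\<dots> = (\<Sum>j<n. \<Sum>i<m. conjugate (A $$ (i, j)) * (r * u $ i) * conjugate (v $ j))"
    by (intro sum.cong refl) (simp add: lv sum_distrib_right)
  also have "\<dots> = (\<Sum>i<m. \<Sum>j<n. conjugate (A $$ (i, j)) * (r * u $ i) * conjugate (v $ j))"
    by (rule sum.swap)
  also have "\<dots> = (\<Sum>i<m. r * u $ i * conjugate (\<Sum>j<n. A $$ (i, j) * v $ j))"
    unfolding conjugate_sum_mult sum_distrib_left by (intro sum.cong refl) (simp add: mult_ac)
  also have "\<dots> = (\<Sum>i<m. r * u $ i * (r * conjugate (u $ i)))"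
    by (intro sum.cong refl) (simp add: Avi conjugate_dist_mul r(1))
  also have "\<dots> = r * r * (\<Sum>i<m. u $ i * conjugate (u $ i))"
    by (simp add: sum_distrib_left mult_ac)
  finally have lr: "l = r * r" using u by (simp add: unit_norm_def)
  show ?thesis
  proof (rule eq_vecI)
    fix i assume "i < dim_vec (r \<cdot>\<^sub>v v)"
    then have i: "i < n" using vn by simp
    have "r \<cdot>\<^sub>v (adj A *\<^sub>v u) = l \<cdot>\<^sub>v v"
      using eig mult_mat_vec_smult[OF adj_carrier[OF A] um, of r] unfolding Av by simp
    then have "(r \<cdot>\<^sub>v (adj A *\<^sub>v u)) $ i = (l \<cdot>\<^sub>v v) $ i" by simp
    then have "r * (adj A *\<^sub>v u) $ i = r * (r * v $ i)"
      using i vn A by (simp add: lr mult_ac)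
    then show "(adj A *\<^sub>v u) $ i = (r \<cdot>\<^sub>v v) $ i" using r(2) i vn by simp
  qed (use A vn in auto)
qed

theorem svd_exists:
  assumes "A \<in> carrier_mat m n"
  shows "has_svd m n A"
  using assms
proof (induction n arbitrary: m A)
  case 0
  have "A = 1\<^sub>m m * A * adj (1\<^sub>m 0)" using 0 by simp
  then show ?case unfolding has_svd_def using unitary_one 0 by (metis not_less_zero)
next
  case (Suc n m A)
  obtain l v0 where l: "conjugate l = l" and v0: "v0 \<in> carrier_vec (Suc n)" "v0 \<noteq> 0\<^sub>v (Suc n)"
    "adj A *\<^sub>v (A *\<^sub>v v0) = l \<cdot>\<^sub>v v0"
    by (rule gram_eigenvector_exists[OF Suc.prems]) auto
  obtain c v where c: "c \<noteq> 0" and v: "unit_norm (Suc n) v" "v0 = c \<cdot>\<^sub>v v"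
    by (rule normalize_vec[OF v0(1,2)])
  have vn: "v \<in> carrier_vec (Suc n)" using v by (simp add: unit_norm_def)
  note A = Suc.prems
  have eig: "adj A *\<^sub>v (A *\<^sub>v v) = l \<cdot>\<^sub>v v"
  proof (rule eq_vecI)
    fix i assume "i < dim_vec (l \<cdot>\<^sub>v v)"
    then have i: "i < Suc n" using vn by simp
    have "c \<cdot>\<^sub>v (adj A *\<^sub>v (A *\<^sub>v v)) = l \<cdot>\<^sub>v (c \<cdot>\<^sub>v v)"
      using v0(3) vn A unfolding v(2) by (simp add: mult_mat_vec_smult[of _ m "Suc n"] mult_mat_vec_smult[of _ "Suc n" m])
    then have "(c \<cdot>\<^sub>v (adj A *\<^sub>v (A *\<^sub>v v))) $ i = (l \<cdot>\<^sub>v (c \<cdot>\<^sub>v v)) $ i" by simp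
    then have "c * (adj A *\<^sub>v (A *\<^sub>v v)) $ i = c * (l * v $ i)"
      using i vn A by (simp add: mult_ac)
    then show "(adj A *\<^sub>v (A *\<^sub>v v)) $ i = (l \<cdot>\<^sub>v v) $ i" using c i vn by simp
  qed (use A vn in auto)
  show ?case
  proof (cases "A *\<^sub>v v = 0\<^sub>v m")
    case True
    obtain V where V: "unitary_mat (Suc n) V" "col V n = v"
      by (rule unitary_with_column[OF v(1), of n]) auto
    have Vc: "V \<in> carrier_mat (Suc n) (Suc n)" using V by (simp add: unitary_mat_def)
    define B where "B = adj (1\<^sub>m m) * A * V"
    have B: "B \<in> carrier_mat m (Suc n)" using A Vc by (simp add: B_def)
    have last: "B $$ (i, n) = 0" if "i < m" for i
    proof -
      have "B $$ (i, n) = (A *\<^sub>v col V n) $ i" using that A Vc by (simp add: B_def)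
      then show ?thesis using True V(2) that by simp
    qed
    \<comment> \<open>the zero column goes to the end, where it does not move the diagonal of the remaining block\<close>
    define A' where "A' = mat m n (\<lambda>(i, j). B $$ (i, j))"
    have "B = four_block_mat A' (0\<^sub>m m 1) (0\<^sub>m 0 n) (0\<^sub>m 0 1)"
      by (rule eq_matI) (use B last in \<open>auto simp: A'_def less_Suc_eq\<close>)
    moreover have "has_svd m n A'" "A' \<in> carrier_mat m n"
      using Suc.IH[of A' m] by (auto simp: A'_def)
    ultimately have "has_svd m (Suc n) B" using has_svd_zero_column[of m n A'] by simp
    from has_svd_unitary[OF unitary_one V(1) this] show ?thesis
      using unitary_decompose[OF unitary_one V(1) A] by (simp add: B_def)
  next
    case False
    have Av: "A *\<^sub>v v \<in> carrier_vec m" using A vn by simp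
    obtain r u where r: "conjugate r = r" "r \<noteq> 0" and u: "unit_norm m u" "A *\<^sub>v v = r \<cdot>\<^sub>v u"
      by (rule normalize_vec[OF Av False])
    have um: "u \<in> carrier_vec m" using u by (simp add: unit_norm_def)
    have "m \<noteq> 0"
    proof
      assume "m = 0"
      then have "A *\<^sub>v v = 0\<^sub>v m" using A by (intro eq_vecI) auto
      with False show False by simp
    qed
    then obtain m' where m': "m = Suc m'" using not0_implies_Suc by blast
    have Au: "adj A *\<^sub>v u = r \<cdot>\<^sub>v v"
      by (rule left_singular_vector[OF A v(1) u(1) r u(2) eig])
    obtain V where V: "unitary_mat (Suc n) V" "col V 0 = v"
      by (rule unitary_with_column[OF v(1), of 0]) auto
    obtain U where U: "unitary_mat m U" "col U 0 = u"
      by (rule unitary_with_column[OF u(1), of 0]) (use m' in auto)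
    have Vc: "V \<in> carrier_mat (Suc n) (Suc n)" and Uc: "U \<in> carrier_mat m m"
      using V U by (simp_all add: unitary_mat_def)
    define B where "B = adj U * A * V"
    have B: "B \<in> carrier_mat m (Suc n)" using A Vc Uc unfolding B_def by (auto intro!: mult_carrier_mat)
    have first_col: "B $$ (i, 0) = (if i = 0 then r else 0)" if "i < m" for i
    proof -
      have "B = adj U * (A * V)"
        unfolding B_def using A Vc Uc by (intro assoc_mult_mat[of _ m m _ "Suc n" _ "Suc n"]) simp_all
      then have "col B 0 = adj U *\<^sub>v (A *\<^sub>v col V 0)"
        using A Vc Uc by (simp add: col_mult2[of _ m m _ "Suc n"] col_mult2[of _ m "Suc n" _ "Suc n"])
      also have "\<dots> = r \<cdot>\<^sub>v (adj U *\<^sub>v col U 0)"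
        using Uc um by (simp add: V(2) U(2) u(2) mult_mat_vec_smult[of _ m m])
      finally have "col B 0 $ i = (r \<cdot>\<^sub>v (adj U *\<^sub>v col U 0)) $ i" by simp
      then show ?thesis using that B Uc m' unitary_adj_col[OF U(1), of 0 i] by simp
    qed
    have first_row: "B $$ (0, j) = (if j = 0 then r else 0)" if j: "j < Suc n" for j
    proof -
      have adjB: "adj B = adj V * (adj A * U)"
      proof -
        have "adj U * A \<in> carrier_mat m (Suc n)" using A Uc by (auto intro!: mult_carrier_mat)
        then have "adj B = adj V * adj (adj U * A)"
          unfolding B_def using Vc by (rule adj_mult)
        also have "adj (adj U * A) = adj A * U"
          using adj_mult[OF adj_carrier[OF Uc] A] by simp
        finally show ?thesis .
      qed
      have "col (adj B) 0 = adj V *\<^sub>v (adj A *\<^sub>v col U 0)"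
      proof -
        have "adj A * U \<in> carrier_mat (Suc n) m" using A Uc by (auto intro!: mult_carrier_mat)
        then have "col (adj B) 0 = adj V *\<^sub>v col (adj A * U) 0"
          unfolding adjB using Vc m' by (intro col_mult2[of _ "Suc n" "Suc n" _ m]) auto
        also have "col (adj A * U) 0 = adj A *\<^sub>v col U 0"
          using A Uc m' by (intro col_mult2[of _ "Suc n" m _ m]) auto
        finally show ?thesis .
      qed
      also have "\<dots> = r \<cdot>\<^sub>v (adj V *\<^sub>v col V 0)"
        using Vc vn by (simp add: V(2) U(2) Au mult_mat_vec_smult[of _ "Suc n" "Suc n"])
      finally have "col (adj B) 0 $ j = (r \<cdot>\<^sub>v (adj V *\<^sub>v col V 0)) $ j" by simp
      then have "conjugate (B $$ (0, j)) = (if j = 0 then r else 0)"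
        using j B Vc m' unitary_adj_col[OF V(1), of 0 j] by simp
      then show ?thesis using r(1) by (metis conjugate_id conjugate_zero)
    qed
    define A' where "A' = mat m' n (\<lambda>(i, j). B $$ (Suc i, Suc j))"
    have "B = four_block_mat (mat 1 1 (\<lambda>_. r)) (0\<^sub>m 1 n) (0\<^sub>m m' 1) A'"
      by (rule eq_matI) (use B m' first_col first_row in \<open>auto simp: A'_def less_Suc_eq_0_disj\<close>)
    moreover have "has_svd m' n A'" "A' \<in> carrier_mat m' n"
      using Suc.IH[of A' m'] by (auto simp: A'_def)
    ultimately have "has_svd m (Suc n) B" using has_svd_bordered[of m' n A' r] r(1) m' by simp
    from has_svd_unitary[OF U(1) V(1) this] show ?thesis
      using unitary_decompose[OF U(1) V(1) A] by (simp add: B_def)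
  qed
qed

section \<open>From the real line back to the unit circle\<close>

lemma near_circle_conj:
  assumes "near_circle P" "near_circle Q"
  shows "near_circle (\<lambda>z. P z \<and> Q z)"
proof -
  from assms obtain S T where "open S" "sphere 0 1 \<subseteq> S" "\<forall>z\<in>S. P z" "open T" "sphere 0 1 \<subseteq> T" "\<forall>z\<in>T. Q z"
    unfolding near_circle_def by blast
  then show ?thesis unfolding near_circle_def by (intro exI[of _ "S \<inter> T"]) auto
qed

lemma near_circle_mono:
  assumes "near_circle P" "\<And>z. P z \<Longrightarrow> Q z"
  shows "near_circle Q"
  using assms unfolding near_circle_def by blast

lemma near_circle_True: "near_circle (\<lambda>z. True)"
  unfolding near_circle_def by (intro exI[of _ UNIV]) auto

lemma near_circle_nonzero: "near_circle (\<lambda>z. z \<noteq> 0)"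
  unfolding near_circle_def by (intro exI[of _ "- {0}"]) auto

lemma near_circle_all_less:
  assumes "\<And>i. i < (n::nat) \<Longrightarrow> near_circle (P i)"
  shows "near_circle (\<lambda>z. \<forall>i<n. P i z)"
  using assms
proof (induction n)
  case 0
  then show ?case using near_circle_True by simp
next
  case (Suc n)
  have "near_circle (\<lambda>z. (\<forall>i<n. P i z) \<and> P n z)"
    using Suc by (intro near_circle_conj) auto
  then show ?case by (rule near_circle_mono) (auto simp: less_Suc_eq)
qed

text \<open>The complex parameter $t$ with $e^{\mathrm i t} = z$: its real part is the principal argument of $z$ and
its imaginary part is $-\log |z|$. It is discontinuous along the negative real axis, like \<open>proot\<close>.\<close>

definition angle :: "complex \<Rightarrow> complex" where
  "angle z = - \<i> * Ln z"

definition circle_fun :: "puis \<Rightarrow> complex \<Rightarrow> complex" where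
  "circle_fun f z = ext f (angle z)"

lemma exp_angle:
  assumes "z \<noteq> 0" "0 < N"
  shows "exp (\<i> * angle z / of_nat N) = proot N z"
proof -
  have "\<i> * angle z / of_nat N = of_real (ln (cmod z) / N) + \<i> * of_real (Arg z) / of_nat N"
    using assms by (simp add: angle_def Ln_Arg field_simps)
  moreover have "exp (complex_of_real (ln (cmod z) / N)) = of_real (root N (cmod z))"
    using assms by (simp add: root_powr_inverse powr_def flip: exp_of_real)
  ultimately show ?thesis by (simp add: exp_add proot_def)
qed

text \<open>The branch cut does no harm: the imaginary part of the angle is small on an annulus, whatever the
argument is.\<close>

lemma near_circle_angle:
  assumes "eventually P near_line"
  shows "near_circle (\<lambda>z. P (angle z))"
proof -
  obtain e where e: "e > 0" "\<And>z. z \<in> strip e \<Longrightarrow> P z"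
    using assms unfolding eventually_near_line by blast
  define T :: "complex set" where "T = ball 0 (exp e) - cball 0 (exp (- e))"
  have "open T" unfolding T_def by (intro open_Diff open_ball closed_cball)
  moreover have "sphere 0 1 \<subseteq> T" using e(1) by (auto simp: T_def)
  moreover have "P (angle z)" if "z \<in> T" for z
  proof (rule e(2))
    have z: "cmod z < exp e" "exp (- e) < cmod z" using that by (auto simp: T_def)
    then have pos: "0 < cmod z" by (meson exp_gt_zero order.strict_trans)
    have "ln (cmod z) < e" using z(1) pos by (metis exp_ln exp_less_cancel_iff)
    moreover have "- e < ln (cmod z)" using z(2) pos by (metis exp_ln exp_less_cancel_iff)
    ultimately show "angle z \<in> strip e" using pos by (simp add: angle_def)
  qed
  ultimately show ?thesis unfolding near_circle_def by blast
qed

lemma angle_inverse_cnj: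
  assumes "z \<noteq> 0"
  shows "angle (inverse (cnj z)) = cnj (angle z)"
proof -
  have "inverse (cnj z) = complex_of_real (1 / (cmod z)\<^sup>2) * z"
    using assms complex_norm_square[of z] by (simp add: field_simps)
  moreover have "0 < 1 / (cmod z)\<^sup>2" using assms by simp
  ultimately have "Arg (inverse (cnj z)) = Arg z"
    using Arg_times_of_real by presburger
  moreover have "ln (cmod (inverse (cnj z))) = - ln (cmod z)"
    using assms by (simp add: norm_inverse ln_inverse)
  ultimately show ?thesis
    using assms by (simp add: angle_def Ln_Arg algebra_simps)
qed

lemma circle_fun_puiseux: "circle_fun f \<in> puiseux_circle"
proof (rule ext_rep[of f])
  fix N g assume *: "0 < (N::nat)" "g analytic_on sphere 0 1" "\<And>z. ext f z = g (exp (\<i> * z / of_nat N))"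
  have "near_circle (\<lambda>z. circle_fun f z = g (proot N z))"
    by (rule near_circle_mono[OF near_circle_nonzero]) (simp add: circle_fun_def * exp_angle)
  then show ?thesis
    using * unfolding puiseux_circle_def holo_root_circle_def holo_circle_def by blast
qed

text \<open>The representation of \<open>p\<close> on the circle that its extension uses may differ from the given one, but
both give the same function on the real line, hence on a strip.\<close>

lemma puiseux_is_circle_fun:
  assumes "f \<in> puiseux_circle"
  shows "\<exists>p. near_circle (\<lambda>z. f z = circle_fun p z)"
proof -
  obtain N g where *: "0 < N" "g analytic_on sphere 0 1" "near_circle (\<lambda>z. f z = g (proot N z))"
    using assms unfolding puiseux_circle_def holo_root_circle_def holo_circle_def by auto
  define p where "p = Abs_puis (\<lambda>t. g (cis (t / of_nat N)))"
  have p: "val p t = g (cis (t / of_nat N))" for t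
    unfolding p_def by (subst Abs_puis_inverse) (use * in \<open>auto intro: line_puiseuxI\<close>)
  have "\<forall>\<^sub>F z in near_line. ext p z = g (exp (\<i> * z / of_nat N))"
    by (intro near_line_identity holo_near_line_ext holo_near_line_exp *(1,2)) (simp add: p cis_conv_exp)
  then have "near_circle (\<lambda>z. ext p (angle z) = g (exp (\<i> * angle z / of_nat N)))"
    by (rule near_circle_angle)
  from near_circle_conj[OF near_circle_conj[OF this *(3)] near_circle_nonzero]
  have "near_circle (\<lambda>z. f z = circle_fun p z)"
    by (rule near_circle_mono) (auto simp: circle_fun_def exp_angle[OF _ *(1)])
  then show ?thesis by blast
qed

definition ext_mat :: "complex \<Rightarrow> puis mat \<Rightarrow> complex mat" where
  "ext_mat z M = map_mat (\<lambda>f. ext f z) M"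

lemma ext_mat_carrier [simp]: "ext_mat z M \<in> carrier_mat m n \<longleftrightarrow> M \<in> carrier_mat m n"
  by (auto simp: ext_mat_def)

lemma eventually_all_less2:
  assumes "\<And>i j. i < (m::nat) \<Longrightarrow> j < (n::nat) \<Longrightarrow> eventually (P i j) F"
  shows "eventually (\<lambda>z. \<forall>i<m. \<forall>j<n. P i j z) F"
proof -
  have "eventually (\<lambda>z. \<forall>i\<in>{..<m}. \<forall>j\<in>{..<n}. P i j z) F"
    using assms by (intro eventually_ball_finite ballI) auto
  then show ?thesis by (rule eventually_mono) auto
qed

lemma ext_mat_mult:
  assumes "A \<in> carrier_mat l m" "B \<in> carrier_mat m n"
  shows "\<forall>\<^sub>F z in near_line. ext_mat z (A * B) = ext_mat z A * ext_mat z B"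
proof -
  have "\<forall>\<^sub>F z in near_line. \<forall>i<l. \<forall>j<n. ext (\<Sum>k\<in>{0..<m}. A $$ (i, k) * B $$ (k, j)) z
      = (\<Sum>k\<in>{0..<m}. ext (A $$ (i, k)) z * ext (B $$ (k, j)) z)"
    by (intro eventually_all_less2 ext_sum_mult)
  then show ?thesis
    by (rule eventually_mono) (intro eq_matI, use assms in \<open>auto simp: ext_mat_def scalar_prod_def\<close>)
qed

lemma ext_mat_adj:
  "\<forall>\<^sub>F z in near_line. ext_mat z (adj A) = map_mat cnj (transpose_mat (ext_mat (cnj z) A))"
proof -
  have "\<forall>\<^sub>F z in near_line. \<forall>i<dim_row A. \<forall>j<dim_col A. ext (conjugate (A $$ (i, j))) z = cnj (ext (A $$ (i, j)) (cnj z))"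
    by (intro eventually_all_less2 ext_conjugate)
  then show ?thesis
    by (rule eventually_mono) (intro eq_matI, auto simp: ext_mat_def)
qed

lemma ext_mat_one: "\<forall>\<^sub>F z in near_line. ext_mat z (1\<^sub>m n) = 1\<^sub>m n"
  using ext_1 by (rule eventually_mono) (intro eq_matI, auto simp: ext_mat_def)

definition circle_mat :: "puis mat \<Rightarrow> complex \<Rightarrow> complex mat" where
  "circle_mat M z = ext_mat (angle z) M"

lemma circle_mat_puiseux:
  assumes "M \<in> carrier_mat m n"
  shows "circle_mat M \<in> puiseux_mat m n"
proof -
  have "(\<lambda>z. circle_mat M z $$ (i, j)) = circle_fun (M $$ (i, j))" if "i < m" "j < n" for i j
    using that assms by (auto simp: circle_mat_def ext_mat_def circle_fun_def)
  then show ?thesis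
    using assms circle_fun_puiseux by (auto simp: puiseux_mat_def circle_mat_def)
qed

lemma para_conj_circle_mat: "near_circle (\<lambda>z. para_conj (circle_mat M) z = ext_mat (angle z) (adj M))"
proof -
  from near_circle_conj[OF near_circle_angle[OF ext_mat_adj[of M]] near_circle_nonzero]
  show ?thesis
    by (rule near_circle_mono) (auto simp: para_conj_def circle_mat_def angle_inverse_cnj)
qed

lemma para_unitary_circle_mat:
  assumes "unitary_mat n U"
  shows "para_unitary n (circle_mat U)"
proof -
  have U: "U \<in> carrier_mat n n" "adj U \<in> carrier_mat n n" "U * adj U = 1\<^sub>m n" "adj U * U = 1\<^sub>m n"
    using assms by (auto simp: unitary_mat_def)
  have "\<forall>\<^sub>F z in near_line. ext_mat z U * ext_mat z (adj U) = 1\<^sub>m n \<and> ext_mat z (adj U) * ext_mat z U = 1\<^sub>m n"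
    using ext_mat_mult[OF U(1,2)] ext_mat_mult[OF U(2,1)] ext_mat_one[of n]
    by eventually_elim (simp add: U(3,4))
  from near_circle_conj[OF near_circle_angle[OF this] para_conj_circle_mat[of U]]
  have "near_circle (\<lambda>z. circle_mat U z * para_conj (circle_mat U) z = 1\<^sub>m n \<and> para_conj (circle_mat U) z * circle_mat U z = 1\<^sub>m n)"
    by (rule near_circle_mono) (simp add: circle_mat_def)
  then show ?thesis
    using circle_mat_puiseux[OF U(1)] by (simp add: para_unitary_def)
qed

lemma puiseux_mat_is_circle_mat:
  assumes "A \<in> puiseux_mat m n"
  obtains M where "M \<in> carrier_mat m n" "near_circle (\<lambda>z. A z = circle_mat M z)"
proof -
  have A: "A z \<in> carrier_mat m n" for z using assms by (simp add: puiseux_mat_def)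
  have "\<forall>i<m. \<forall>j<n. \<exists>p. near_circle (\<lambda>z. A z $$ (i, j) = circle_fun p z)"
    using assms puiseux_is_circle_fun by (simp add: puiseux_mat_def)
  then obtain p where p: "\<And>i j. i < m \<Longrightarrow> j < n \<Longrightarrow> near_circle (\<lambda>z. A z $$ (i, j) = circle_fun (p i j) z)"
    by metis
  define M where "M = mat m n (\<lambda>(i, j). p i j)"
  have "near_circle (\<lambda>z. \<forall>i<m. \<forall>j<n. A z $$ (i, j) = circle_fun (p i j) z)"
    by (intro near_circle_all_less p)
  then have "near_circle (\<lambda>z. A z = circle_mat M z)"
    by (rule near_circle_mono, intro eq_matI)
       (use A in \<open>auto simp: M_def circle_mat_def ext_mat_def circle_fun_def\<close>)
  then show ?thesis by (intro that[of M]) (simp_all add: M_def)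
qed

theorem theorem4p1:
  fixes m n :: nat and A :: "complex \<Rightarrow> complex mat"
  assumes "A \<in> puiseux_mat m n"
  shows "\<exists>U S V. para_unitary m U \<and> para_unitary n V \<and> S \<in> puiseux_mat m n \<and>
           near_circle (\<lambda>z. diagonal_mat (S z)) \<and>
           (\<forall>z\<in>sphere 0 1. \<forall>i<m. \<forall>j<n. S z $$ (i, j) \<in> \<real>) \<and>
           near_circle (\<lambda>z. A z = U z * S z * para_conj V z)"
proof -
  obtain M where M: "M \<in> carrier_mat m n" "near_circle (\<lambda>z. A z = circle_mat M z)"
    by (rule puiseux_mat_is_circle_mat[OF assms])
  obtain U S V where svd: "unitary_mat m U" "unitary_mat n V" "S \<in> carrier_mat m n"
    "\<And>i j. i < m \<Longrightarrow> j < n \<Longrightarrow> i \<noteq> j \<Longrightarrow> S $$ (i, j) = 0"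
    "\<And>i j. i < m \<Longrightarrow> j < n \<Longrightarrow> conjugate (S $$ (i, j)) = S $$ (i, j)"
    "M = U * S * adj V"
    using svd_exists[OF M(1)] unfolding has_svd_def by blast
  have c: "U \<in> carrier_mat m m" "adj V \<in> carrier_mat n n" "U * S \<in> carrier_mat m n"
    using svd(1,2,3) by (auto simp: unitary_mat_def)
  have "\<forall>\<^sub>F z in near_line. ext_mat z M = ext_mat z U * ext_mat z S * ext_mat z (adj V)"
    using ext_mat_mult[OF c(1) svd(3)] ext_mat_mult[OF c(3,2)]
    by eventually_elim (simp add: svd(6))
  from near_circle_conj[OF near_circle_conj[OF near_circle_angle[OF this] para_conj_circle_mat[of V]] M(2)]
  have "near_circle (\<lambda>z. A z = circle_mat U z * circle_mat S z * para_conj (circle_mat V) z)"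
    by (rule near_circle_mono) (simp add: circle_mat_def)
  moreover have "near_circle (\<lambda>z. diagonal_mat (circle_mat S z))"
    by (rule near_circle_mono[OF near_circle_True])
       (use svd(3,4) in \<open>auto simp: diagonal_mat_def circle_mat_def ext_mat_def\<close>)
  moreover have "circle_mat S z $$ (i, j) \<in> \<real>" if "z \<in> sphere 0 1" "i < m" "j < n" for z i j
  proof -
    have "z \<noteq> 0" using that(1) by auto
    then have "angle z = complex_of_real (Arg z)"
      using that(1) by (simp add: angle_def Ln_Arg)
    then have "circle_mat S z $$ (i, j) = val (S $$ (i, j)) (Arg z)"
      using that svd(3) by (simp add: circle_mat_def ext_mat_def)
    moreover have "cnj (val (S $$ (i, j)) (Arg z)) = val (S $$ (i, j)) (Arg z)"
      using svd(5)[OF that(2,3)] by (metis val_conjugate)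
    ultimately show ?thesis by (simp add: Reals_cnj_iff)
  qed
  ultimately show ?thesis
    using para_unitary_circle_mat[OF svd(1)] para_unitary_circle_mat[OF svd(2)] circle_mat_puiseux[OF svd(3)]
    by blast
qed

end
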